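(* Let $W=W(E_8)$ be the Coxeter group of type $E_8$ with longest element $w_o$ (which is central and acts as $-1$ in the reflection representation). The involutions in $W$ form exactly ten conjugacy classes, namely the pairwise distinct classes $[w_\emptyset]$, $[w_{\{1,2,3,4,5,6,7,8\}}]$, $[w_{\{1\}}]=[w_{\{3\}}]$, $[w_{\{1,2,3,4,5,6,7\}}]$, $[w_{\{1,4\}}]=[w_{\{1,5\}}]$, $[w_{\{2,3,4,5,6,7\}}]$, $[w_{\{1,4,6\}}]=[w_{\{1,2,8\}}]$, $[w_{\{2,3,4,5,7\}}]=[w_{\{2,3,4,5,8\}}]$, $[w_{\{1,4,6,8\}}]=[w_{\{1,2,6,8\}}]$, $[w_{\{2,3,4,5\}}]$. Multiplication by $w_o=-1$ acts on these classes as follows: (1) it interchanges $[w_\emptyset]$ and $[w_{\{1,2,3,4,5,6,7,8\}}]$; (2) it interchanges $[w_{\{1\}}]$ and $[w_{\{1,2,3,4,5,6,7\}}]$; (3) it interchanges $[w_{\{1,4\}}]$ and $[w_{\{2,3,4,5,6,7\}}]$; (4) it interchanges $[w_{\{1,4,6\}}]$ and $[w_{\{2,3,4,5,7\}}]$; (5) it fixes $[w_{\{1,4,6,8\}}]$; (6) it fixes $[w_{\{2,3,4,5\}}]$.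
   Context: The nodes of the Coxeter graph $E_8$ are numbered as in Bourbaki: nodes $1,3,4,5,6,7,8$ form a path in this order and node $2$ is joined to node $4$; all edges have label $3$. Node $i$ corresponds to the simple generator $s_i$. For a set of nodes $I$, $W_I$ denotes the parabolic subgroup generated by $\{s_i: i\in I\}$, and $w_I$ denotes its longest element ($w_\emptyset=1$). An involution is an element $x$ with $x^2=1$ (the identity is included); $[x]$ denotes the conjugacy class of $x$ in $W$. *)

theory Defs
  imports Complex_Main "HOL-Algebra.Generated_Groups" "HOL-Algebra.Bij"
begin

section \<open>Coxeter groups\<close>

text \<open>
  A Coxeter matrix on a set \<open>S\<close> is a function \<open>m\<close> with \<open>m s s = 1\<close> for all \<open>s\<close>, and \<open>0\<close> stands for
  the label infinity. The Coxeter group is the group presented by generators \<open>S\<close> and relations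
  \<open>(s t)^m(s,t) = 1\<close>. It is realised as the set of words over \<open>S\<close> modulo the congruence generated
  by these relations; no formal inverses are needed since the relations with \<open>s = t\<close> read
  \<open>s s = 1\<close>.
\<close>

inductive_set coxeter_rel :: "'a set \<Rightarrow> ('a \<Rightarrow> 'a \<Rightarrow> nat) \<Rightarrow> ('a list \<times> 'a list) set"
  for S :: "'a set" and m :: "'a \<Rightarrow> 'a \<Rightarrow> nat"
where
  refl: "xs \<in> lists S \<Longrightarrow> (xs, xs) \<in> coxeter_rel S m"
| sym: "(xs, ys) \<in> coxeter_rel S m \<Longrightarrow> (ys, xs) \<in> coxeter_rel S m"
| trans: "(xs, ys) \<in> coxeter_rel S m \<Longrightarrow> (ys, zs) \<in> coxeter_rel S m \<Longrightarrow> (xs, zs) \<in> coxeter_rel S m"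
| rel: "xs \<in> lists S \<Longrightarrow> ys \<in> lists S \<Longrightarrow> s \<in> S \<Longrightarrow> t \<in> S \<Longrightarrow>
    (xs @ concat (replicate (m s t) [s, t]) @ ys, xs @ ys) \<in> coxeter_rel S m"

definition coxeter_group :: "'a set \<Rightarrow> ('a \<Rightarrow> 'a \<Rightarrow> nat) \<Rightarrow> 'a list set monoid" where
  "coxeter_group S m =
    \<lparr>carrier = lists S // coxeter_rel S m,
     mult = (\<lambda>A B. coxeter_rel S m `` {xs @ ys | xs ys. xs \<in> A \<and> ys \<in> B}),
     one = coxeter_rel S m `` {[]}\<rparr>"

definition simple_gen :: "'a set \<Rightarrow> ('a \<Rightarrow> 'a \<Rightarrow> nat) \<Rightarrow> 'a \<Rightarrow> 'a list set" where
  "simple_gen S m s = coxeter_rel S m `` {[s]}"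

definition coxeter_length :: "'a list set \<Rightarrow> nat" where
  "coxeter_length w = (LEAST n. \<exists>xs\<in>w. length xs = n)"

definition parabolic :: "'a set \<Rightarrow> ('a \<Rightarrow> 'a \<Rightarrow> nat) \<Rightarrow> 'a set \<Rightarrow> 'a list set set" where
  "parabolic S m I = generate (coxeter_group S m) (simple_gen S m ` I)"

text \<open>Meaningful only if \<open>parabolic S m I\<close> is finite; then the element of maximal length is unique.\<close>

definition longest_element :: "'a set \<Rightarrow> ('a \<Rightarrow> 'a \<Rightarrow> nat) \<Rightarrow> 'a set \<Rightarrow> 'a list set" where
  "longest_element S m I =
    (THE w. w \<in> parabolic S m I \<and> (\<forall>v\<in>parabolic S m I. coxeter_length v \<le> coxeter_length w))"

text \<open>
  The reflection representation, for finite \<open>S\<close>: the vector space with basis \<open>\<alpha>\<^sub>s\<close> (\<open>s \<in> S\<close>) consists of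
  the coordinate functions vanishing outside \<open>S\<close>, with
  \<open>B(\<alpha>\<^sub>s, \<alpha>\<^sub>t) = - cos (\<pi> / m s t)\<close>, to be read as \<open>-1\<close> for label infinity; in that case
  the definition below gives \<open>- cos (\<pi> / 0) = - cos 0 = -1\<close>.
\<close>

definition refl_space :: "'a set \<Rightarrow> ('a \<Rightarrow> real) set" where
  "refl_space S = {v. \<forall>s. s \<notin> S \<longrightarrow> v s = 0}"

definition simple_reflection :: "'a set \<Rightarrow> ('a \<Rightarrow> 'a \<Rightarrow> nat) \<Rightarrow> 'a \<Rightarrow> ('a \<Rightarrow> real) \<Rightarrow> ('a \<Rightarrow> real)" where
  "simple_reflection S m s v =
    v(s := v s - 2 * (\<Sum>t\<in>S. - cos (pi / real (m s t)) * v t))"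

text \<open>
  On the carrier of the group this determines \<open>\<rho>\<close> uniquely, since the simple generators generate.
\<close>

definition is_reflection_rep ::
  "'a set \<Rightarrow> ('a \<Rightarrow> 'a \<Rightarrow> nat) \<Rightarrow> ('a list set \<Rightarrow> ('a \<Rightarrow> real) \<Rightarrow> ('a \<Rightarrow> real)) \<Rightarrow> bool" where
  "is_reflection_rep S m \<rho> \<longleftrightarrow>
    \<rho> \<in> hom (coxeter_group S m) (BijGroup (refl_space S)) \<and>
    (\<forall>s\<in>S. \<forall>v\<in>refl_space S. \<rho> (simple_gen S m s) v = simple_reflection S m s v)"

lemma coxeter_rel_in_lists:
  assumes "(xs, ys) \<in> coxeter_rel S m"
  shows "xs \<in> lists S \<and> ys \<in> lists S"
  using assms
proof induction
  case (rel xs ys s t)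
  moreover have "set (concat (replicate (m s t) [s, t])) \<subseteq> {s, t}"
    by (auto split: if_splits)
  ultimately show ?case
    by (auto simp: in_lists_conv_set simp del: set_concat set_replicate_conv_if)
qed auto

lemma equiv_coxeter_rel: "equiv (lists S) (coxeter_rel S m)"
proof (rule equivI)
  show "coxeter_rel S m \<subseteq> lists S \<times> lists S"
    using coxeter_rel_in_lists by fast
  show "refl_on (lists S) (coxeter_rel S m)"
    by (auto simp: refl_on_def intro: coxeter_rel.refl)
  show "sym (coxeter_rel S m)"
    by (rule symI) (rule coxeter_rel.sym)
  show "trans (coxeter_rel S m)"
    by (rule transI) (rule coxeter_rel.trans)
qed

lemma coxeter_rel_append_left:
  assumes "(xs, ys) \<in> coxeter_rel S m" "zs \<in> lists S"
  shows "(zs @ xs, zs @ ys) \<in> coxeter_rel S m"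
  using assms
proof induction
  case (rel xs ys s t)
  then show ?case
    using coxeter_rel.rel[of "zs @ xs" S ys s t m] by simp
next
  case (refl xs)
  then show ?case
    by (intro coxeter_rel.refl) simp
qed (auto intro: coxeter_rel.sym coxeter_rel.trans)

lemma coxeter_rel_append_right:
  assumes "(xs, ys) \<in> coxeter_rel S m" "zs \<in> lists S"
  shows "(xs @ zs, ys @ zs) \<in> coxeter_rel S m"
  using assms
proof induction
  case (rel xs ys s t)
  then show ?case
    using coxeter_rel.rel[of xs S "ys @ zs" s t m] by simp
next
  case (refl xs)
  then show ?case
    by (intro coxeter_rel.refl) simp
qed (auto intro: coxeter_rel.sym coxeter_rel.trans)

lemma coxeter_rel_append:
  assumes "(xs, xs') \<in> coxeter_rel S m" "(ys, ys') \<in> coxeter_rel S m"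
  shows "(xs @ ys, xs' @ ys') \<in> coxeter_rel S m"
  by (meson assms coxeter_rel.trans coxeter_rel_append_left coxeter_rel_append_right
      coxeter_rel_in_lists)

lemma coxeter_mult_class:
  assumes "xs \<in> lists S" "ys \<in> lists S"
  shows "coxeter_rel S m `` {xs} \<otimes>\<^bsub>coxeter_group S m\<^esub> coxeter_rel S m `` {ys}
       = coxeter_rel S m `` {xs @ ys}"
  using assms
  by (auto simp: coxeter_group_def intro: coxeter_rel_append coxeter_rel.trans coxeter_rel.refl)

lemma rev_word_coxeter_rel:
  assumes "\<And>s. s \<in> S \<Longrightarrow> m s s = 1" "xs \<in> lists S"
  shows "(rev xs @ xs, []) \<in> coxeter_rel S m"
  using assms(2)
proof (induction xs)
  case (Cons s xs)
  have "(rev xs @ concat (replicate (m s s) [s, s]) @ xs, rev xs @ xs) \<in> coxeter_rel S m"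
    using Cons by (intro coxeter_rel.rel) auto
  with Cons assms(1)[of s] show ?case
    by (auto intro: coxeter_rel.trans)
qed (auto intro: coxeter_rel.refl)

lemma group_coxeter_group:
  assumes "\<And>s. s \<in> S \<Longrightarrow> m s s = 1"
  shows "group (coxeter_group S m)"
proof (rule groupI)
  let ?W = "coxeter_group S m" and ?R = "coxeter_rel S m"
  have carr: "carrier ?W = lists S // ?R" and one: "\<one>\<^bsub>?W\<^esub> = ?R `` {[]}"
    by (simp_all add: coxeter_group_def)
  show "\<one>\<^bsub>?W\<^esub> \<in> carrier ?W"
    unfolding carr one by (auto intro: quotientI)
  fix x assume "x \<in> carrier ?W"
  then obtain xs where xs: "xs \<in> lists S" "x = ?R `` {xs}"
    unfolding carr by (rule quotientE)
  show "\<one>\<^bsub>?W\<^esub> \<otimes>\<^bsub>?W\<^esub> x = x"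
    using xs by (simp add: one coxeter_mult_class)
  have "?R `` {rev xs} \<otimes>\<^bsub>?W\<^esub> x = \<one>\<^bsub>?W\<^esub>"
    using xs assms rev_word_coxeter_rel[of S m xs]
    by (simp add: one coxeter_mult_class in_lists_conv_set equiv_class_eq[OF equiv_coxeter_rel])
  then show "\<exists>y\<in>carrier ?W. y \<otimes>\<^bsub>?W\<^esub> x = \<one>\<^bsub>?W\<^esub>"
    using xs unfolding carr by (auto intro!: bexI quotientI simp: in_lists_conv_set)
  fix y assume "y \<in> carrier ?W"
  then obtain ys where ys: "ys \<in> lists S" "y = ?R `` {ys}"
    unfolding carr by (rule quotientE)
  show "x \<otimes>\<^bsub>?W\<^esub> y \<in> carrier ?W"
    using xs ys by (auto simp add: coxeter_mult_class carr simp del: in_lists_conv_set intro!: quotientI)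
  fix z assume "z \<in> carrier ?W"
  then obtain zs where zs: "zs \<in> lists S" "z = ?R `` {zs}"
    unfolding carr by (rule quotientE)
  show "x \<otimes>\<^bsub>?W\<^esub> y \<otimes>\<^bsub>?W\<^esub> z = x \<otimes>\<^bsub>?W\<^esub> (y \<otimes>\<^bsub>?W\<^esub> z)"
    using xs ys zs by (simp add: coxeter_mult_class)
qed

section \<open>Conjugacy classes of involutions\<close>

definition conj_class :: "('a, 'b) monoid_scheme \<Rightarrow> 'a \<Rightarrow> 'a set" where
  "conj_class G x = {g \<otimes>\<^bsub>G\<^esub> x \<otimes>\<^bsub>G\<^esub> inv\<^bsub>G\<^esub> g | g. g \<in> carrier G}"

text \<open>By convention the identity is an involution.\<close>

definition involutions :: "('a, 'b) monoid_scheme \<Rightarrow> 'a set" where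
  "involutions G = {x \<in> carrier G. x \<otimes>\<^bsub>G\<^esub> x = \<one>\<^bsub>G\<^esub>}"

section \<open>Type \<open>E\<^sub>8\<close>\<close>

abbreviation E8_nodes :: "nat set" where
  "E8_nodes \<equiv> {1..8}"

definition E8_edges :: "nat set set" where
  "E8_edges = {{1,3}, {3,4}, {4,5}, {5,6}, {6,7}, {7,8}, {2,4}}"

definition E8_matrix :: "nat \<Rightarrow> nat \<Rightarrow> nat" where
  "E8_matrix i j = (if i = j then 1 else if {i, j} \<in> E8_edges then 3 else 2)"

definition W_E8 :: "nat list set monoid" where
  "W_E8 = coxeter_group E8_nodes E8_matrix"

definition w_E8 :: "nat set \<Rightarrow> nat list set" where
  "w_E8 I = longest_element E8_nodes E8_matrix I"

definition wo_E8 :: "nat list set" where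
  "wo_E8 = w_E8 E8_nodes"

definition cl_E8 :: "nat set \<Rightarrow> nat list set set" where
  "cl_E8 I = conj_class W_E8 (w_E8 I)"

lemma group_W_E8: "group W_E8"
  unfolding W_E8_def by (rule group_coxeter_group) (simp add: E8_matrix_def)

end

(*
  A simply laced Coxeter group acts faithfully on its reflection representation, and when there is a
  finite set of positive roots the length of an element is the number of positive roots it makes
  negative.  Hence a word over I acting as -1 on the simple roots of I represents w_I; for all the
  sets I considered here w_I does act as -1.

  A nontrivial involution negates some root (conjugate by simple reflections until a descent is
  negated), and dividing by the reflection in that root gives an involution fixing it.  So every
  involution is a product of reflections in pairwise orthogonal roots.  Up to conjugation these may
  be chosen along the chain of highest roots of E8, E7, D6 and then inside A1 + D4, which leaves a
  finite list of words; each is conjugate to y or to -y for one of six short words y.  The ten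
  classes are separated by the number of positive roots which their elements negate.
*)

theory Submission
  imports Defs
begin

section \<open>Simply laced Coxeter groups\<close>

text \<open>The group is given by a presentation, so words are compared through their action. Once
  this is known to be faithful, a claim about elements becomes a computation with the images of the
  eight simple roots, written as integer lists; labels 2 and 3 keep the form integral.
  \<open>P\<close> is not constructed from the group: it is any finite set of nonzero nonnegative
  vectors that contains the simple roots and whose members, apart from \<open>alpha s\<close>, are
  kept in the set by the reflection in \<open>s\<close>. For E8 this is a check on a list of 120
  vectors.

  The number k of orthogonal reflections is the dimension of the -1 eigenspace, so it is a class
  invariant, and multiplication by -1 turns k into 8 - k. Each k from 0 to 8 gives one class, except
  that k = 4 splits into the type of \<open>[1,4,6,8]\<close> and that of \<open>w4\<close>; this
  makes ten, and both types with k = 4 are stable under -1. Dimension cannot separate these two,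
  whereas the number of negated roots, 4 against 12, does.\<close>

locale simply_laced =
  fixes S :: "'a set" and m :: "'a \<Rightarrow> 'a \<Rightarrow> nat"
  assumes finite_S: "finite S"
    and m_diag: "s \<in> S \<Longrightarrow> m s s = 1"
    and m_sym: "s \<in> S \<Longrightarrow> t \<in> S \<Longrightarrow> m s t = m t s"
    and m_offdiag: "s \<in> S \<Longrightarrow> t \<in> S \<Longrightarrow> s \<noteq> t \<Longrightarrow> m s t = 2 \<or> m s t = 3"
begin

abbreviation R where "R \<equiv> coxeter_rel S m"

definition cls :: "'a list \<Rightarrow> 'a list set" where
  "cls xs = R `` {xs}"

text \<open>Twice the bilinear form of the Coxeter matrix on simple roots: labels 1, 2, 3 give 2, 0,
  -1.\<close>

definition cartan :: "'a \<Rightarrow> 'a \<Rightarrow> real" where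
  "cartan s t = (if s = t then 2 else if m s t = 3 then -1 else 0)"

definition pairing :: "'a \<Rightarrow> ('a \<Rightarrow> real) \<Rightarrow> real" where
  "pairing s v = (\<Sum>t\<in>S. cartan s t * v t)"

definition alpha :: "'a \<Rightarrow> 'a \<Rightarrow> real" where
  "alpha s = (\<lambda>i. if i = s then 1 else 0)"

text \<open>Written with \<open>+ -\<close> to be an instance of \<open>v i + c * w i\<close>, the
  one shape in which linearity of \<open>pairing\<close>, \<open>act\<close> and \<open>form\<close>
  is stated.\<close>

definition refl :: "'a \<Rightarrow> ('a \<Rightarrow> real) \<Rightarrow> 'a \<Rightarrow> real" where
  "refl s v = (\<lambda>i. v i + - pairing s v * alpha s i)"

definition act :: "'a list \<Rightarrow> ('a \<Rightarrow> real) \<Rightarrow> 'a \<Rightarrow> real" where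
  "act xs v = foldr refl xs v"

lemma act_Nil [simp]: "act [] v = v"
  and act_Cons [simp]: "act (s # xs) v = refl s (act xs v)"
  and act_append [simp]: "act (xs @ ys) v = act xs (act ys v)"
  by (simp_all add: act_def)

lemma simple_reflection_eq_refl:
  assumes "s \<in> S"
  shows "simple_reflection S m s = refl s"
proof
  fix v
  have "2 * (- cos (pi / real (m s t))) = cartan s t" if "t \<in> S" for t
  proof (cases "s = t")
    case True
    then show ?thesis using assms by (simp add: m_diag cartan_def)
  next
    case False
    then have "m s t = 2 \<or> m s t = 3"
      by (rule m_offdiag[OF assms that])
    with False show ?thesis
      by (elim disjE) (simp_all add: cartan_def cos_60)
  qed
  then have "pairing s v = 2 * (\<Sum>t\<in>S. - cos (pi / real (m s t)) * v t)"
    unfolding pairing_def sum_distrib_left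
    by (intro sum.cong HOL.refl) (simp only: mult.assoc [symmetric])
  then show "simple_reflection S m s v = refl s v"
    unfolding simple_reflection_def refl_def alpha_def by (simp only: fun_eq_iff fun_upd_apply) simp
qed

lemma pairing_linear: "pairing s (\<lambda>i. v i + c * w i) = pairing s v + c * pairing s w"
  by (simp add: pairing_def algebra_simps sum.distrib sum_distrib_left)

lemma pairing_alpha: "t \<in> S \<Longrightarrow> pairing s (alpha t) = cartan s t"
  by (simp add: pairing_def alpha_def finite_S if_distrib cong: if_cong)

lemma cartan_sym: "s \<in> S \<Longrightarrow> t \<in> S \<Longrightarrow> cartan s t = cartan t s"
  by (simp add: cartan_def m_sym)

lemma pairing_refl: "s \<in> S \<Longrightarrow> pairing t (refl s v) = pairing t v - pairing s v * cartan t s"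
  unfolding refl_def pairing_linear by (simp add: pairing_alpha)

lemma refl_linear: "refl s (\<lambda>i. v i + c * w i) = (\<lambda>i. refl s v i + c * refl s w i)"
  by (auto simp: refl_def pairing_linear algebra_simps)

lemma act_linear: "act xs (\<lambda>i. v i + c * w i) = (\<lambda>i. act xs v i + c * act xs w i)"
  by (induction xs) (simp_all add: refl_linear)

lemma act_zero: "act xs (\<lambda>i. 0) = (\<lambda>i. 0)"
  using act_linear[of xs "\<lambda>i. 0" 1 "\<lambda>i. 0"] by (simp add: fun_eq_iff)

lemma act_minus: "act xs (\<lambda>i. - v i) = (\<lambda>i. - act xs v i)"
  using act_linear[of xs "\<lambda>i. 0" "-1" v] by (simp add: act_zero)

lemma act_sum: "finite I \<Longrightarrow> act xs (\<lambda>i. \<Sum>j\<in>I. c j * f j i) = (\<lambda>i. \<Sum>j\<in>I. c j * act xs (f j) i)"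
proof (induction I rule: finite_induct)
  case (insert j I)
  have "act xs (\<lambda>i. \<Sum>k\<in>insert j I. c k * f k i)
      = act xs (\<lambda>i. (\<Sum>k\<in>I. c k * f k i) + c j * f j i)"
    using insert by (simp add: add.commute)
  then show ?case
    using insert by (simp add: act_linear) (simp add: add.commute)
qed (simp add: act_zero)

lemma refl_refl: "s \<in> S \<Longrightarrow> refl s (refl s v) = v"
  by (rule ext) (simp add: refl_def[of s "refl s v"] pairing_refl cartan_def, simp add: refl_def)

lemma act_rev:
  assumes "xs \<in> lists S"
  shows "act (rev xs) (act xs v) = v" "act xs (act (rev xs) v) = v"
  using assms by (induction xs arbitrary: v) (simp_all add: refl_refl)

lemma refl_apply: "refl s v i = v i - pairing s v * alpha s i"
  by (simp add: refl_def)

lemma refl_relation: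
  assumes "s \<in> S" "t \<in> S"
  shows "act (concat (replicate (m s t) [s, t])) v = v"
proof (cases "s = t")
  case True
  then show ?thesis using assms by (simp add: m_diag refl_refl)
next
  case False
  have diag: "cartan s s = 2" "cartan t t = 2"
    by (simp_all add: cartan_def)
  from False consider "m s t = 2" "cartan s t = 0" "cartan t s = 0"
    | "m s t = 3" "cartan s t = -1" "cartan t s = -1"
    using m_offdiag[of s t] m_sym[of s t] assms by (auto simp: cartan_def)
  then show ?thesis
  proof cases
    case 1
    then show ?thesis
      by (intro ext) (simp add: numeral_eq_Suc refl_apply pairing_refl assms diag algebra_simps)
  next
    case 2
    then show ?thesis
      by (intro ext) (simp add: numeral_3_eq_3 refl_apply pairing_refl assms diag algebra_simps)
  qed
qed

lemma act_cong_rel: "(xs, ys) \<in> R \<Longrightarrow> act xs v = act ys v"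
  by (induction arbitrary: v rule: coxeter_rel.induct) (simp_all add: refl_relation)

lemma cls_eq_iff: "xs \<in> lists S \<Longrightarrow> ys \<in> lists S \<Longrightarrow> cls xs = cls ys \<longleftrightarrow> (xs, ys) \<in> R"
  unfolding cls_def by (rule eq_equiv_class_iff[OF equiv_coxeter_rel])

lemma act_cong: "cls xs = cls ys \<Longrightarrow> xs \<in> lists S \<Longrightarrow> ys \<in> lists S \<Longrightarrow> act xs = act ys"
  using act_cong_rel by (auto simp: cls_eq_iff)

lemma cls_append_cong:
  assumes "cls xs = cls xs'" "cls ys = cls ys'"
    "xs \<in> lists S" "xs' \<in> lists S" "ys \<in> lists S" "ys' \<in> lists S"
  shows "cls (xs @ ys) = cls (xs' @ ys')"
  using assms coxeter_rel_append[of xs xs' S m ys ys'] by (auto simp: cls_eq_iff)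

lemma cls_cancel:
  assumes "xs \<in> lists S" "ys \<in> lists S" "s \<in> S"
  shows "cls (xs @ s # s # ys) = cls (xs @ ys)"
  using assms coxeter_rel.rel[of xs S ys s s m] by (simp add: m_diag cls_eq_iff)

lemma cls_rev:
  assumes "xs \<in> lists S"
  shows "cls (rev xs @ xs) = cls []" "cls (xs @ rev xs) = cls []"
  using assms rev_word_coxeter_rel[of S m xs] rev_word_coxeter_rel[of S m "rev xs"] m_diag
  by (auto simp: cls_eq_iff in_lists_conv_set)

lemma cls_commute:
  assumes "xs \<in> lists S" "s \<in> S" "t \<in> S" "m s t = 2"
  shows "cls (xs @ [s, t]) = cls (xs @ [t, s])"
proof -
  \<comment> \<open>The second \<open>[s, t]\<close> cancels against \<open>rev [s, t]\<close>; read
    the other way, the two copies of \<open>[s, t]\<close> form the relator \<open>(s t)^2\<close>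
    and only \<open>rev [s, t]\<close> survives.\<close>
  have "cls (xs @ [s, t]) = cls (xs @ [s, t] @ [s, t] @ rev [s, t])"
    using assms cls_cancel[of "xs @ [s, t, s]" "[s]" t] cls_cancel[of "xs @ [s,t]" "[]" s] by simp
  also have "\<dots> = cls (xs @ rev [s, t])"
    using assms coxeter_rel.rel[of xs S "rev [s, t]" s t m]
    by (simp add: numeral_eq_Suc cls_eq_iff)
  finally show ?thesis by simp
qed

text \<open>As for commutation: \<open>[s, t, s] @ [t, s, t]\<close> is the relator
  \<open>(s t)^3\<close>.\<close>

lemma cls_braid:
  assumes "xs \<in> lists S" "s \<in> S" "t \<in> S" "m s t = 3"
  shows "cls (xs @ [s, t, s]) = cls (xs @ [t, s, t])"
proof -
  have "cls (xs @ [s, t, s]) = cls (xs @ [s, t, s] @ [t, s, t] @ rev [t, s, t])"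
    using assms cls_cancel[of "xs @ [s, t, s, t, s]" "[s, t]" t]
      cls_cancel[of "xs @ [s, t, s, t]" "[t]" s] cls_cancel[of "xs @ [s, t, s]" "[]" t] by simp
  also have "\<dots> = cls (xs @ rev [t, s, t])"
    using assms coxeter_rel.rel[of xs S "rev [t, s, t]" s t m]
    by (simp add: numeral_eq_Suc cls_eq_iff)
  finally show ?thesis by simp
qed

text \<open>Every relator has even length. This parity (the sign character) is what forces the
  length to change when a generator is multiplied on.\<close>

lemma even_length_rel: "(xs, ys) \<in> R \<Longrightarrow> even (length xs) \<longleftrightarrow> even (length ys)"
proof (induction rule: coxeter_rel.induct)
  case (rel xs ys s t)
  have "even (length (concat (replicate k [s, t])))" for k
    by (induction k) simp_all
  then show ?case by simp
qed simp_all

subsection \<open>Length and positivity\<close>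

abbreviation len :: "'a list \<Rightarrow> nat" where
  "len xs \<equiv> coxeter_length (cls xs)"

lemma mem_cls_iff:
  assumes "xs \<in> lists S"
  shows "ys \<in> cls xs \<longleftrightarrow> ys \<in> lists S \<and> cls ys = cls xs"
proof -
  have "ys \<in> cls xs \<longleftrightarrow> (xs, ys) \<in> R"
    by (simp add: cls_def)
  then show ?thesis
    using coxeter_rel_in_lists[of xs ys S m] cls_eq_iff[of xs ys] assms by metis
qed

lemma len_le: "xs \<in> lists S \<Longrightarrow> len xs \<le> length xs"
  unfolding coxeter_length_def using mem_cls_iff[of xs xs] by (intro Least_le) blast

lemma ex_reduced:
  assumes "xs \<in> lists S"
  obtains ys where "ys \<in> lists S" "cls ys = cls xs" "length ys = len xs"
proof -
  have "\<exists>ys\<in>cls xs. length ys = len xs"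
    unfolding coxeter_length_def by (rule LeastI_ex) (use assms mem_cls_iff in blast)
  then show ?thesis using that mem_cls_iff[OF assms] by blast
qed

lemma even_len:
  assumes "xs \<in> lists S"
  shows "even (len xs) \<longleftrightarrow> even (length xs)"
proof -
  obtain ys where "ys \<in> lists S" "cls ys = cls xs" "length ys = len xs"
    using assms by (rule ex_reduced)
  then show ?thesis
    using even_length_rel[of ys xs] assms by (simp add: cls_eq_iff)
qed

lemma len_append_le:
  assumes "xs \<in> lists S" "ys \<in> lists S"
  shows "len (xs @ ys) \<le> len xs + length ys"
proof -
  obtain zs where "zs \<in> lists S" "cls zs = cls xs" "length zs = len xs"
    using assms(1) by (rule ex_reduced)
  then show ?thesis
    using cls_append_cong[of zs xs ys ys] len_le[of "zs @ ys"] assms by simp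
qed

lemma len_snoc:
  assumes "xs \<in> lists S" "s \<in> S"
  shows "len (xs @ [s]) = len xs + 1 \<or> len xs = len (xs @ [s]) + 1"
proof -
  have "len (xs @ [s]) \<le> len xs + 1" "len (xs @ [s, s]) \<le> len (xs @ [s]) + 1"
    using len_append_le[of xs "[s]"] len_append_le[of "xs @ [s]" "[s]"] assms by auto
  moreover have "len (xs @ [s, s]) = len xs"
    using cls_cancel[of xs "[]" s] assms by simp
  moreover have "even (len (xs @ [s])) \<noteq> even (len xs)"
    using even_len[of "xs @ [s]"] even_len[of xs] assms by simp
  then have "len (xs @ [s]) \<noteq> len xs"
    by metis
  ultimately show ?thesis
    by linarith
qed

lemma len_eq_0_iff:
  assumes "xs \<in> lists S"
  shows "len xs = 0 \<longleftrightarrow> cls xs = cls []"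
proof -
  obtain zs where "zs \<in> lists S" "cls zs = cls xs" "length zs = len xs"
    using assms(1) by (rule ex_reduced)
  then show ?thesis using len_le[of "[]"] by auto
qed

lemma ex_descent:
  assumes "xs \<in> lists S" "cls xs \<noteq> cls []"
  obtains ys t where "ys \<in> lists S" "t \<in> S" "cls xs = cls (ys @ [t])" "len xs = len ys + 1"
proof -
  obtain zs where zs: "zs \<in> lists S" "cls zs = cls xs" "length zs = len xs"
    using assms(1) by (rule ex_reduced)
  with assms obtain ys t where ys: "zs = ys @ [t]"
    by (cases zs rule: rev_cases) auto
  have "len xs \<le> len ys + 1"
    using zs ys len_append_le[of ys "[t]"] by simp
  moreover have "len ys \<le> length ys"
    using zs ys by (intro len_le) simp
  ultimately show ?thesis
    using that[of ys t] zs ys by simp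
qed

text \<open>In the simply laced case the rank-two computation of the usual proof reduces to
  \<open>t \<alpha>\<^sub>s = \<alpha>\<^sub>s\<close> or \<open>t \<alpha>\<^sub>s = \<alpha>\<^sub>s + \<alpha>\<^sub>t\<close>.\<close>

lemma act_alpha_nonneg:
  assumes "xs \<in> lists S" "s \<in> S" "len xs < len (xs @ [s])"
  shows "0 \<le> act xs (alpha s) i"
  using assms
proof (induction "len xs" arbitrary: xs s rule: less_induct)
  case less
  show ?case
  proof (cases "cls xs = cls []")
    case True
    then show ?thesis
      using act_cong[of xs "[]"] less.prems by (simp add: alpha_def)
  next
    case False
    then obtain ys t where ys: "ys \<in> lists S" "t \<in> S" "cls xs = cls (ys @ [t])"
        "len xs = len ys + 1"
      using ex_descent less.prems(1) by metis
    have act: "act xs v = act ys (refl t v)" for v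
      using act_cong[OF ys(3)] ys less.prems by simp
    have xss: "cls (xs @ [s]) = cls (ys @ [t, s])"
      using cls_append_cong[of xs "ys @ [t]" "[s]" "[s]"] ys less.prems by simp
    have "t \<noteq> s"
      using xss cls_cancel[of ys "[]" s] ys less.prems by auto
    have ys_t: "len ys < len (ys @ [t])"
      using ys by simp
    consider "m s t = 2" "cartan t s = 0" | "m s t = 3" "cartan t s = -1"
      using m_offdiag[of s t] m_sym[of s t] ys(2) less.prems(2) \<open>t \<noteq> s\<close> by (auto simp: cartan_def)
    then show ?thesis
    proof cases
      case 1
      then have "cls (xs @ [s]) = cls ((ys @ [s]) @ [t])"
        using cls_commute[of ys s t] xss ys less.prems by simp
      then have "len ys < len (ys @ [s])"
        using len_snoc[of ys s] len_append_le[of "ys @ [s]" "[t]"] ys less.prems by auto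
      then have "0 \<le> act ys (alpha s) i"
        using less.hyps ys less.prems by simp
      then show ?thesis
        using 1 ys less.prems by (simp add: act refl_def[of t] pairing_alpha)
    next
      case 2
      have rt: "act xs (alpha s) = (\<lambda>i. act ys (alpha s) i + act ys (alpha t) i)"
        using 2 ys less.prems act_linear[of ys "alpha s" 1 "alpha t"]
        by (simp add: act refl_def[of t] pairing_alpha)
      show ?thesis
      proof (cases "len ys < len (ys @ [s])")
        case True
        then have "0 \<le> act ys (alpha s) i" "0 \<le> act ys (alpha t) i"
          using less.hyps ys less.prems ys_t by simp_all
        then show ?thesis by (simp add: rt)
      next
        case False
        \<comment> \<open>Here \<open>s\<close> is a descent of \<open>ys\<close> too, so
          \<open>xs\<close> equals \<open>zs\<close> followed by \<open>s t\<close>. Since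
          \<open>s t\<close> carries \<open>alpha s\<close> to \<open>alpha t\<close>, the question
          passes to \<open>zs\<close> and \<open>t\<close>, and the braid relation supplies the
          length inequality needed there.\<close>
        define zs where "zs = ys @ [s]"
        have zs: "zs \<in> lists S" "len ys = len zs + 1"
          using False len_snoc[of ys s] ys less.prems by (auto simp: zs_def)
        have ys': "cls ys = cls (zs @ [s])"
          using cls_cancel[of ys "[]" s] ys less.prems by (simp add: zs_def)
        have "cls (xs @ [s]) = cls ((zs @ [s]) @ [t, s])"
          unfolding xss using cls_append_cong[OF ys', of "[t, s]" "[t, s]"] ys zs less.prems by simp
        also have "\<dots> = cls ((zs @ [t]) @ [s, t])"
          using cls_braid[of zs s t] 2 zs ys less.prems by simp
        finally have "len (xs @ [s]) \<le> len (zs @ [t]) + 2"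
          using len_append_le[of "zs @ [t]" "[s, t]"] zs ys less.prems by simp
        then have "len zs < len (zs @ [t])"
          using less.prems zs ys len_snoc[of zs t] by auto
        then have "0 \<le> act zs (alpha t) i"
          using less.hyps ys zs by simp
        moreover have "act ys v = act zs (refl s v)" for v
          using act_cong[OF ys'] ys zs less.prems by simp
        then have "act xs (alpha s) = act zs (refl s (refl t (alpha s)))"
          by (simp add: act)
        moreover have "refl s (refl t (alpha s)) = alpha t"
        proof
          have "pairing s (alpha s) = 2" "pairing s (alpha t) = -1" "pairing t (alpha s) = -1"
            using 2 ys less.prems \<open>t \<noteq> s\<close> by (auto simp: pairing_alpha cartan_def)
          then show "refl s (refl t (alpha s)) i = alpha t i" for i
            using ys less.prems by (simp add: refl_def pairing_linear)
              (simp add: pairing_linear[where c = 1, simplified])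
        qed
        ultimately show ?thesis by simp
      qed
    qed
  qed
qed

lemma act_alpha_nonpos:
  assumes "xs \<in> lists S" "s \<in> S" "len (xs @ [s]) < len xs"
  shows "act xs (alpha s) i \<le> 0"
proof -
  have "0 \<le> act (xs @ [s]) (alpha s) i"
    using assms cls_cancel[of xs "[]" s] by (intro act_alpha_nonneg) simp_all
  moreover have "refl s (alpha s) = (\<lambda>i. - alpha s i)"
    using assms by (auto simp: refl_def pairing_alpha cartan_def)
  ultimately show ?thesis
    by (simp add: act_minus)
qed

lemma act_alpha_neq_zero:
  assumes "xs \<in> lists S"
  shows "act xs (alpha s) \<noteq> (\<lambda>i. 0)"
proof
  assume "act xs (alpha s) = (\<lambda>i. 0)"
  then have "alpha s = (\<lambda>i. 0)"
    using act_rev(1)[OF assms, of "alpha s"] by (simp only: act_zero)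
  then have "alpha s s = 0"
    by (rule fun_cong)
  then show False
    by (simp add: alpha_def)
qed

text \<open>A nontrivial element has a right descent, and it sends that simple root to a vector
  without positive coordinates. Asking for a single positive coordinate suits both uses: the
  identity in \<open>faithful\<close>, and mere positivity of images for longest elements.\<close>

lemma cls_eq_NilI:
  assumes "xs \<in> lists S" "\<And>s. s \<in> S \<Longrightarrow> \<exists>i. act xs (alpha s) i > 0"
  shows "cls xs = cls []"
proof (rule ccontr)
  assume "cls xs \<noteq> cls []"
  then obtain ys t where ys: "ys \<in> lists S" "t \<in> S" "cls xs = cls (ys @ [t])"
      "len xs = len ys + 1"
    using ex_descent assms(1) by metis
  have "cls (xs @ [t]) = cls ys"
    using cls_append_cong[OF ys(3), of "[t]" "[t]"] cls_cancel[of ys "[]" t] ys assms(1) by simp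
  then show False
    using assms(2)[OF ys(2)] act_alpha_nonpos[OF assms(1) ys(2)] ys(4) by (auto simp: not_le[symmetric])
qed

lemma faithful:
  assumes "xs \<in> lists S" "ys \<in> lists S" "\<And>s. s \<in> S \<Longrightarrow> act xs (alpha s) = act ys (alpha s)"
  shows "cls xs = cls ys"
proof -
  have "cls (rev xs @ ys) = cls []"
  proof (rule cls_eq_NilI)
    fix s assume "s \<in> S"
    then have "act (rev xs @ ys) (alpha s) = alpha s"
      using assms act_rev(1) by (simp flip: assms(3))
    then show "\<exists>i. act (rev xs @ ys) (alpha s) i > 0"
      by (auto simp: alpha_def)
  qed (use assms in \<open>auto simp: in_lists_conv_set\<close>)
  then have "cls (xs @ rev xs @ ys) = cls (xs @ [])"
    using assms by (intro cls_append_cong) (auto simp: in_lists_conv_set)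
  moreover have "cls ((xs @ rev xs) @ ys) = cls ([] @ ys)"
    using assms cls_rev(2) by (intro cls_append_cong) (auto simp: in_lists_conv_set)
  ultimately show ?thesis by simp
qed

lemma cls_eq_iff_act:
  assumes "xs \<in> lists S" "ys \<in> lists S"
  shows "cls xs = cls ys \<longleftrightarrow> (\<forall>v. act xs v = act ys v)"
  using assms act_cong faithful by metis

lemma rev_in_lists [simp]: "rev xs \<in> lists A \<longleftrightarrow> xs \<in> lists A"
  by (simp add: in_lists_conv_set)

lemma cls_rev_cong:
  assumes "cls xs = cls ys" "xs \<in> lists S" "ys \<in> lists S"
  shows "cls (rev xs) = cls (rev ys)"
proof (rule faithful)
  fix s
  have "act (rev xs) (alpha s) = act (rev xs) (act ys (act (rev ys) (alpha s)))"
    using assms act_rev(2) by simp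
  also have "\<dots> = act (rev ys) (alpha s)"
    using act_rev(1)[OF assms(2)] act_cong[OF assms] by simp
  finally show "act (rev xs) (alpha s) = act (rev ys) (alpha s)" .
qed (use assms in auto)

lemma len_rev:
  assumes "xs \<in> lists S"
  shows "len (rev xs) = len xs"
proof -
  have "len (rev xs) \<le> len xs" if xs: "xs \<in> lists S" for xs
  proof -
    obtain ys where "ys \<in> lists S" "cls ys = cls xs" "length ys = len xs"
      using xs by (rule ex_reduced)
    then show ?thesis
      using len_le[of "rev ys"] cls_rev_cong[of ys xs] xs by auto
  qed
  from this[of xs] this[of "rev xs"] assms show ?thesis by auto
qed

subsection \<open>The group of classes of words\<close>

abbreviation W where "W \<equiv> coxeter_group S m"

lemma group_W: "group W"
  by (rule group_coxeter_group) (rule m_diag)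

lemma carrier_W: "carrier W = cls ` lists S"
  by (auto simp: coxeter_group_def cls_def quotient_def)

lemma one_W: "\<one>\<^bsub>W\<^esub> = cls []"
  by (simp add: coxeter_group_def cls_def)

lemma mult_W: "xs \<in> lists S \<Longrightarrow> ys \<in> lists S \<Longrightarrow> cls xs \<otimes>\<^bsub>W\<^esub> cls ys = cls (xs @ ys)"
  unfolding cls_def by (rule coxeter_mult_class)

lemma inv_W:
  assumes "xs \<in> lists S"
  shows "inv\<^bsub>W\<^esub> (cls xs) = cls (rev xs)"
proof -
  interpret group W by (rule group_W)
  show ?thesis
    using assms cls_rev(1)[OF assms] by (intro inv_equality) (simp_all add: mult_W one_W carrier_W)
qed

text \<open>Generators are their own inverses, so \<open>generate\<close> yields only products of
  generators.\<close>

lemma parabolic_eq: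
  assumes "I \<subseteq> S"
  shows "parabolic S m I = cls ` lists I"
proof
  have "x \<in> cls ` lists I" if "x \<in> parabolic S m I" for x
    using that unfolding parabolic_def
  proof (induction rule: generate.induct)
    case one
    then show ?case by (auto simp: one_W)
  next
    case (incl h)
    then show ?case by (auto simp: simple_gen_def cls_def)
  next
    case (inv h)
    then obtain i where i: "i \<in> I" "h = cls [i]"
      by (auto simp: simple_gen_def cls_def)
    then have "inv\<^bsub>W\<^esub> h = cls [i]"
      using inv_W[of "[i]"] assms by auto
    then show ?case using i by (intro image_eqI[of _ _ "[i]"]) auto
  next
    case (eng h1 h2)
    then obtain xs ys where "xs \<in> lists I" "ys \<in> lists I" "h1 = cls xs" "h2 = cls ys"
      by blast
    then show ?case
      using assms mult_W[of xs ys] by (intro image_eqI[of _ _ "xs @ ys"]) auto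
  qed
  then show "parabolic S m I \<subseteq> cls ` lists I" by blast
  have "cls xs \<in> parabolic S m I" if "xs \<in> lists I" for xs
    using that
  proof (induction xs)
    case Nil
    show ?case
      unfolding parabolic_def one_W[symmetric] by (rule generate.one)
  next
    case (Cons x xs)
    have "cls [x] \<in> parabolic S m I"
      unfolding parabolic_def using Cons
      by (intro generate.incl) (auto simp: simple_gen_def cls_def)
    then have "cls [x] \<otimes>\<^bsub>W\<^esub> cls xs \<in> parabolic S m I"
      using Cons unfolding parabolic_def by (intro generate.eng) auto
    then show ?case using Cons assms by (subst (asm) mult_W) auto
  qed
  then show "cls ` lists I \<subseteq> parabolic S m I" by blast
qed

lemma act_outside:
  assumes "xs \<in> lists I" "i \<notin> I"
  shows "act xs v i = v i"
  using assms by (induction xs) (auto simp: refl_apply alpha_def)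

lemma ex_reflection_rep:
  "\<exists>\<rho>. is_reflection_rep S m \<rho> \<and> (\<forall>xs\<in>lists S. \<forall>v\<in>refl_space S. \<rho> (cls xs) v = act xs v)"
proof -
  let ?V = "refl_space S"
  \<comment> \<open>A representative word is chosen; \<open>act_cong\<close> makes the choice
    immaterial. The restriction in \<open>\<rho>\<close> provides the extensionality that
    \<open>Bij\<close> demands.\<close>
  define w where "w = (\<lambda>x. SOME xs. xs \<in> lists S \<and> cls xs = x)"
  define \<rho> where "\<rho> = (\<lambda>x. restrict (act (w x)) ?V)"
  have \<rho>: "\<rho> (cls xs) = restrict (act xs) ?V" if "xs \<in> lists S" for xs
  proof -
    have "w (cls xs) \<in> lists S \<and> cls (w (cls xs)) = cls xs"
      unfolding w_def by (rule someI[of _ xs]) (use that in blast)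
    then show ?thesis
      using act_cong[of "w (cls xs)" xs] that by (simp add: \<rho>_def)
  qed
  have closed: "act xs v \<in> ?V" if "xs \<in> lists S" "v \<in> ?V" for xs v
    using that act_outside[of xs S] by (auto simp: refl_space_def)
  have "\<rho> \<in> hom W (BijGroup ?V)"
  proof (rule homI)
    fix x assume "x \<in> carrier W"
    then obtain xs where xs: "xs \<in> lists S" "x = cls xs"
      by (auto simp: carrier_W)
    then have "bij_betw (act xs) ?V ?V"
      using closed[of xs] closed[of "rev xs"] act_rev[of xs]
      by (intro bij_betw_byWitness[of _ "act (rev xs)"]) auto
    then show "\<rho> x \<in> carrier (BijGroup ?V)"
      using xs by (simp add: \<rho> BijGroup_def Bij_def cong: bij_betw_cong)
    fix y assume "y \<in> carrier W"
    then obtain ys where ys: "ys \<in> lists S" "y = cls ys"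
      by (auto simp: carrier_W)
    have "bij_betw (act ys) ?V ?V"
      using ys closed[of ys] closed[of "rev ys"] act_rev[of ys]
      by (intro bij_betw_byWitness[of _ "act (rev ys)"]) auto
    with \<open>bij_betw (act xs) ?V ?V\<close>
    have "restrict (act xs) ?V \<in> Bij ?V" "restrict (act ys) ?V \<in> Bij ?V"
      by (simp_all add: Bij_def cong: bij_betw_cong)
    then show "\<rho> (x \<otimes>\<^bsub>W\<^esub> y) = \<rho> x \<otimes>\<^bsub>BijGroup ?V\<^esub> \<rho> y"
      using xs ys closed[of ys] by (auto simp: mult_W \<rho> BijGroup_def compose_def)
  qed
  moreover have "\<rho> (simple_gen S m s) v = simple_reflection S m s v" if "s \<in> S" "v \<in> ?V" for s v
    using that \<rho>[of "[s]"] by (simp add: simple_gen_def cls_def simple_reflection_eq_refl)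
  ultimately have "is_reflection_rep S m \<rho>"
    by (simp add: is_reflection_rep_def)
  then show ?thesis using \<rho> by (intro exI[of _ \<rho>]) simp
qed

subsection \<open>The invariant form and its reflections\<close>

text \<open>Twice the form B, so that roots have norm 2 and the reflection in a root
  \<open>b\<close> is \<open>v - form v b * b\<close>.\<close>

definition form :: "('a \<Rightarrow> real) \<Rightarrow> ('a \<Rightarrow> real) \<Rightarrow> real" where
  "form v w = (\<Sum>s\<in>S. v s * pairing s w)"

lemma form_sym: "form v w = form w v"
proof -
  have "form v w = (\<Sum>s\<in>S. \<Sum>t\<in>S. v s * cartan s t * w t)"
    by (simp add: form_def pairing_def sum_distrib_left mult.assoc)
  also have "\<dots> = (\<Sum>t\<in>S. \<Sum>s\<in>S. v s * cartan s t * w t)"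
    by (rule sum.swap)
  also have "\<dots> = (\<Sum>t\<in>S. \<Sum>s\<in>S. w t * cartan t s * v s)"
    by (intro sum.cong HOL.refl) (simp add: cartan_sym)
  also have "\<dots> = form w v"
    by (simp add: form_def pairing_def sum_distrib_left mult.assoc)
  finally show ?thesis .
qed

lemma form_linear: "form v (\<lambda>i. w i + c * u i) = form v w + c * form v u"
  by (simp add: form_def pairing_linear algebra_simps sum.distrib sum_distrib_left)

lemma form_linear_left: "form (\<lambda>i. w i + c * u i) v = form w v + c * form u v"
  by (simp add: form_sym[of _ v] form_linear)

lemma form_minus: "form v (\<lambda>i. - w i) = - form v w"
  using form_linear[of v w "-2" w] by simp

lemma form_minus_left: "form (\<lambda>i. - w i) v = - form w v"
  by (simp add: form_sym[of _ v] form_minus)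

lemma form_alpha: "s \<in> S \<Longrightarrow> form (alpha s) v = pairing s v"
  by (simp add: form_def alpha_def finite_S if_distrib[where f = "\<lambda>x. x * _"] cong: if_cong)

lemma form_alpha_right: "s \<in> S \<Longrightarrow> form v (alpha s) = pairing s v"
  by (simp add: form_sym[of v] form_alpha)

lemma form_refl: "s \<in> S \<Longrightarrow> form (refl s v) (refl s w) = form v w"
  unfolding refl_def form_linear form_linear_left
  by (simp add: form_alpha form_alpha_right pairing_alpha cartan_def)

lemma form_act: "xs \<in> lists S \<Longrightarrow> form (act xs v) (act xs w) = form v w"
  by (induction xs) (simp_all add: form_refl)

lemma form_zero_if_negated:
  assumes "xs \<in> lists S" "act xs v = (\<lambda>i. - v i)" "act xs w = w"
  shows "form v w = 0"
  using form_act[OF assms(1), of v w] assms by (simp add: form_minus_left)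

definition reflection_word :: "'a list \<Rightarrow> ('a \<Rightarrow> real) \<Rightarrow> bool" where
  "reflection_word r b \<longleftrightarrow> r \<in> lists S \<and> form b b = 2 \<and> (\<forall>v. act r v = (\<lambda>i. v i + - form v b * b i))"

lemma reflection_word_conj:
  assumes "u \<in> lists S" "s \<in> S"
  shows "reflection_word (u @ [s] @ rev u) (act u (alpha s))"
  unfolding reflection_word_def
proof (intro conjI allI)
  show "u @ [s] @ rev u \<in> lists S" using assms by simp
  show "form (act u (alpha s)) (act u (alpha s)) = 2"
    using assms by (simp add: form_act form_alpha pairing_alpha cartan_def)
  fix v
  have "pairing s (act (rev u) v) = form (act u (act (rev u) v)) (act u (alpha s))"
    using assms by (simp only: form_act form_alpha_right)
  then have "pairing s (act (rev u) v) = form v (act u (alpha s))"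
    using assms by (simp only: act_rev)
  then show "act (u @ [s] @ rev u) v = (\<lambda>i. v i + - form v (act u (alpha s)) * act u (alpha s) i)"
    unfolding act_append act_Cons act_Nil refl_def[of s] act_linear
    using assms by (simp only: act_rev)
qed

lemma reflection_word_simple: "s \<in> S \<Longrightarrow> reflection_word [s] (alpha s)"
  using reflection_word_conj[of "[]" s] by simp

lemma reflection_word_act:
  "reflection_word r b \<Longrightarrow> act r v = (\<lambda>i. v i + - form v b * b i)"
  by (simp only: reflection_word_def)

lemma reflection_word_involutive:
  assumes "reflection_word r b"
  shows "act r (act r v) = v"
proof -
  have "form b b = 2" using assms by (simp add: reflection_word_def)
  then show ?thesis
    unfolding reflection_word_act[OF assms] form_linear_left by simp
qed

lemma reflection_word_fixes:
  assumes "reflection_word r b" "form v b = 0"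
  shows "act r v = v"
  by (simp add: reflection_word_act[OF assms(1)] assms(2))

lemma reflection_word_negates:
  assumes "reflection_word r b"
  shows "act r b = (\<lambda>i. - b i)"
proof -
  have "form b b = 2" using assms by (simp add: reflection_word_def)
  then show ?thesis
    by (auto simp: reflection_word_act[OF assms])
qed

text \<open>\<open>g\<close> conjugates the reflection in \<open>b\<close> to the reflection in
  \<open>act g b\<close>, and opposite roots have the same reflection.\<close>

lemma reflection_word_commutes:
  assumes "reflection_word r b" "g \<in> lists S" "act g b = b \<or> act g b = (\<lambda>i. - b i)"
  shows "act g (act r v) = act r (act g v)"
proof -
  have "form v b = form (act g v) (act g b)"
    using assms(2) by (simp add: form_act)
  then show ?thesis
    using assms(3) unfolding reflection_word_act[OF assms(1)] act_linear
    by (auto simp: form_minus)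
qed

subsection \<open>Conjugate words\<close>

definition conjugate :: "'a list \<Rightarrow> 'a list \<Rightarrow> bool" where
  "conjugate xs ys \<longleftrightarrow> (\<exists>g\<in>lists S. cls (g @ xs @ rev g) = cls ys)"

lemma conjugate_refl: "conjugate xs xs"
  unfolding conjugate_def by (rule bexI[of _ "[]"]) auto

text \<open>The intertwining form contains no inverse of \<open>g\<close>, which is what makes
  conjugacy cheap to check by evaluation.\<close>

lemma conjugateI:
  assumes "g \<in> lists S" "xs \<in> lists S" "ys \<in> lists S"
    "\<And>v. act g (act xs v) = act ys (act g v)"
  shows "conjugate xs ys"
  unfolding conjugate_def
  using assms by (intro bexI[of _ g]) (auto simp: cls_eq_iff_act act_rev)

lemma conjugateE:
  assumes "conjugate xs ys" "xs \<in> lists S" "ys \<in> lists S"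
  obtains g where "g \<in> lists S" "\<And>v. act g (act xs v) = act ys (act g v)"
proof -
  obtain g where g: "g \<in> lists S" "cls (g @ xs @ rev g) = cls ys"
    using assms(1) by (auto simp: conjugate_def)
  then have "act (g @ xs @ rev g) (act g v) = act ys (act g v)" for v
    using assms cls_eq_iff_act[of "g @ xs @ rev g" ys] by simp
  then show ?thesis using that[of g] g act_rev[OF g(1)] by simp
qed

lemma conjugate_trans:
  assumes "conjugate xs ys" "conjugate ys zs" "xs \<in> lists S" "ys \<in> lists S" "zs \<in> lists S"
  shows "conjugate xs zs"
proof -
  obtain g where g: "g \<in> lists S" "\<And>v. act g (act xs v) = act ys (act g v)"
    using assms conjugateE by metis
  obtain h where h: "h \<in> lists S" "\<And>v. act h (act ys v) = act zs (act h v)"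
    using assms conjugateE by metis
  show ?thesis
    using g h assms by (intro conjugateI[of "h @ g"]) simp_all
qed

lemma conjugate_sym:
  assumes "conjugate xs ys" "xs \<in> lists S" "ys \<in> lists S"
  shows "conjugate ys xs"
proof -
  obtain g where g: "g \<in> lists S" "\<And>v. act g (act xs v) = act ys (act g v)"
    using assms conjugateE by metis
  have "act (rev g) (act ys v) = act xs (act (rev g) v)" for v
  proof -
    have "act (rev g) (act ys v) = act (rev g) (act ys (act g (act (rev g) v)))"
      using g(1) by (simp only: act_rev)
    also have "\<dots> = act (rev g) (act g (act xs (act (rev g) v)))"
      by (simp only: g(2))
    finally show ?thesis using g(1) by (simp only: act_rev)
  qed
  then show ?thesis
    using g assms by (intro conjugateI[of "rev g"]) simp_all
qed

lemma conj_class_cls: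
  assumes "xs \<in> lists S"
  shows "conj_class W (cls xs) = {cls ys | ys. ys \<in> lists S \<and> conjugate xs ys}"
proof -
  have "cls g \<otimes>\<^bsub>W\<^esub> cls xs \<otimes>\<^bsub>W\<^esub> inv\<^bsub>W\<^esub> (cls g) = cls (g @ xs @ rev g)" if "g \<in> lists S" for g
    using that assms by (simp add: mult_W inv_W)
  then have "conj_class W (cls xs) = {cls (g @ xs @ rev g) | g. g \<in> lists S}"
    unfolding conj_class_def carrier_W by auto
  also have "\<dots> = {cls ys | ys. ys \<in> lists S \<and> conjugate xs ys}"
  proof (intro equalityI subsetI)
    fix x assume "x \<in> {cls (g @ xs @ rev g) | g. g \<in> lists S}"
    then obtain g where "g \<in> lists S" "x = cls (g @ xs @ rev g)" by blast
    then show "x \<in> {cls ys | ys. ys \<in> lists S \<and> conjugate xs ys}"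
      using assms unfolding conjugate_def
      by (intro CollectI exI[of _ "g @ xs @ rev g"] conjI bexI[of _ g]) auto
  next
    fix x assume "x \<in> {cls ys | ys. ys \<in> lists S \<and> conjugate xs ys}"
    then obtain g ys where "g \<in> lists S" "x = cls ys" "cls (g @ xs @ rev g) = cls ys"
      unfolding conjugate_def by blast
    then show "x \<in> {cls (g @ xs @ rev g) | g. g \<in> lists S}" by force
  qed
  finally show ?thesis .
qed

lemma conj_class_eq_iff:
  assumes "xs \<in> lists S" "ys \<in> lists S"
  shows "conj_class W (cls xs) = conj_class W (cls ys) \<longleftrightarrow> conjugate xs ys"
proof
  assume "conj_class W (cls xs) = conj_class W (cls ys)"
  then have "cls ys \<in> conj_class W (cls xs)"
    using assms conjugate_refl by (auto simp: conj_class_cls)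
  then obtain zs where "zs \<in> lists S" "conjugate xs zs" "cls zs = cls ys"
    using assms by (auto simp: conj_class_cls)
  then show "conjugate xs ys" by (simp add: conjugate_def)
next
  assume c: "conjugate xs ys"
  have "conjugate xs zs \<longleftrightarrow> conjugate ys zs" if "zs \<in> lists S" for zs
    using c assms that conjugate_sym conjugate_trans by metis
  then show "conj_class W (cls xs) = conj_class W (cls ys)"
    using assms by (auto simp: conj_class_cls)
qed

end

section \<open>Finite systems of positive roots, inversions and longest elements\<close>

locale simply_laced_finite = simply_laced S m for S :: "'a set" and m +
  fixes P :: "('a \<Rightarrow> real) set"
  assumes finite_P: "finite P"
    and alpha_in_P: "s \<in> S \<Longrightarrow> alpha s \<in> P"
    and P_nonneg: "b \<in> P \<Longrightarrow> 0 \<le> b i"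
    and P_outside: "b \<in> P \<Longrightarrow> i \<notin> S \<Longrightarrow> b i = 0"
    and P_nonzero: "(\<lambda>i. 0) \<notin> P"
    and refl_P: "b \<in> P \<Longrightarrow> s \<in> S \<Longrightarrow> b \<noteq> alpha s \<Longrightarrow> refl s b \<in> P"
begin

lemma refl_alpha: "s \<in> S \<Longrightarrow> refl s (alpha s) = (\<lambda>i. - alpha s i)"
  by (auto simp: refl_def pairing_alpha cartan_def)

lemma not_both_P: "b \<in> P \<Longrightarrow> (\<lambda>i. - b i) \<notin> P"
proof
  assume "b \<in> P" "(\<lambda>i. - b i) \<in> P"
  then have "b i = 0" for i
    using P_nonneg[of b i] P_nonneg[of "\<lambda>i. - b i" i] by simp
  then have "b = (\<lambda>i. 0)" by auto
  then show False using \<open>b \<in> P\<close> P_nonzero by simp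
qed

lemma act_P:
  assumes "xs \<in> lists S" "b \<in> P"
  shows "act xs b \<in> P \<or> (\<lambda>i. - act xs b i) \<in> P"
  using assms(1)
proof (induction xs)
  case (Cons s xs)
  have pos: "refl s c \<in> P \<or> (\<lambda>i. - refl s c i) \<in> P" if "c \<in> P" for c
    using that Cons refl_P[of c s] alpha_in_P[of s] refl_alpha[of s] by (cases "c = alpha s") auto
  have neg: "refl s (\<lambda>i. - act xs b i) = (\<lambda>i. - refl s (act xs b) i)"
    using act_minus[of "[s]" "act xs b"] by simp
  show ?case
    using Cons pos[of "act xs b"] pos[of "\<lambda>i. - act xs b i"] neg by auto
qed (use assms in simp)

definition inversions :: "'a list \<Rightarrow> ('a \<Rightarrow> real) set" where
  "inversions xs = {b \<in> P. (\<lambda>i. - act xs b i) \<in> P}"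

lemma act_alpha_in_P_iff:
  assumes "xs \<in> lists S" "s \<in> S"
  shows "len xs < len (xs @ [s]) \<longleftrightarrow> act xs (alpha s) \<in> P"
proof
  assume "len xs < len (xs @ [s])"
  then have pos: "0 \<le> act xs (alpha s) i" for i
    using assms act_alpha_nonneg by blast
  have "(\<lambda>i. - act xs (alpha s) i) \<notin> P"
  proof
    assume *: "(\<lambda>i. - act xs (alpha s) i) \<in> P"
    then have "act xs (alpha s) i = 0" for i
      using pos[of i] P_nonneg[OF *, of i] by simp
    then show False
      using act_alpha_neq_zero[OF assms(1), of s] by auto
  qed
  then show "act xs (alpha s) \<in> P"
    using act_P assms alpha_in_P by blast
next
  assume *: "act xs (alpha s) \<in> P"
  show "len xs < len (xs @ [s])"
  proof (rule ccontr)
    assume "\<not> len xs < len (xs @ [s])"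
    then have "act xs (alpha s) i = 0" for i
      using len_snoc[OF assms] act_alpha_nonpos[OF assms, of i] P_nonneg[OF *, of i] by simp
    then show False
      using act_alpha_neq_zero[OF assms(1), of s] by auto
  qed
qed

text \<open>The reflection in \<open>s\<close> permutes the positive roots other than
  \<open>alpha s\<close>. So the inversions of \<open>xs @ [s]\<close> are those of
  \<open>xs\<close> moved by \<open>s\<close>, together with \<open>alpha s\<close>.\<close>

lemma card_inversions_snoc:
  assumes "xs \<in> lists S" "s \<in> S" "len xs < len (xs @ [s])"
  shows "card (inversions (xs @ [s])) = card (inversions xs) + 1"
proof -
  have pos: "act xs (alpha s) \<in> P"
    using assms act_alpha_in_P_iff by blast
  then have notin: "alpha s \<notin> inversions xs"
    using not_both_P by (simp add: inversions_def)
  have "inversions (xs @ [s]) = insert (alpha s) (refl s ` inversions xs)"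
  proof (intro equalityI subsetI)
    fix b assume b: "b \<in> inversions (xs @ [s])"
    show "b \<in> insert (alpha s) (refl s ` inversions xs)"
    proof (cases "b = alpha s")
      case False
      then have "refl s b \<in> inversions xs"
        using b assms refl_P by (simp add: inversions_def)
      then show ?thesis
        using refl_refl[OF assms(2), of b] by (metis image_eqI insertI2)
    qed simp
  next
    fix b assume "b \<in> insert (alpha s) (refl s ` inversions xs)"
    then consider "b = alpha s" | c where "b = refl s c" "c \<in> inversions xs"
      by blast
    then show "b \<in> inversions (xs @ [s])"
    proof cases
      case 1
      then show ?thesis
        using pos assms alpha_in_P by (simp add: inversions_def refl_alpha act_minus)
    next
      case 2
      then show ?thesis
        using assms refl_P[of c s] notin by (auto simp: inversions_def refl_refl)
    qed
  qed
  moreover have "alpha s \<notin> refl s ` inversions xs"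
  proof
    assume "alpha s \<in> refl s ` inversions xs"
    then obtain c where "c \<in> inversions xs" "alpha s = refl s c" by blast
    then have "refl s (alpha s) \<in> P"
      using refl_refl[OF assms(2), of c] by (simp add: inversions_def)
    then show False
      using not_both_P alpha_in_P[OF assms(2)] by (simp add: refl_alpha assms(2))
  qed
  moreover have "inj_on (refl s) (inversions xs)"
    by (rule inj_on_inverseI[of _ "refl s"]) (rule refl_refl[OF assms(2)])
  moreover have "finite (inversions xs)"
    using finite_P by (simp add: inversions_def)
  ultimately show ?thesis by (simp add: card_image)
qed

lemma len_eq_card_inversions:
  assumes "xs \<in> lists S"
  shows "len xs = card (inversions xs)"
  using assms
proof (induction "len xs" arbitrary: xs rule: less_induct)
  case less
  show ?case
  proof (cases "cls xs = cls []")
    case True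
    then have "act xs v = v" for v
      using act_cong[of xs "[]"] less.prems by simp
    then have "inversions xs = {}"
      using not_both_P by (auto simp: inversions_def)
    then show ?thesis
      using True less.prems len_eq_0_iff by simp
  next
    case False
    then obtain ys t where ys: "ys \<in> lists S" "t \<in> S" "cls xs = cls (ys @ [t])"
        "len xs = len ys + 1"
      using ex_descent less.prems(1) by metis
    have "inversions xs = inversions (ys @ [t])"
      using act_cong[OF ys(3)] ys less.prems by (simp add: inversions_def)
    then show ?thesis
      using less.hyps[of ys] ys card_inversions_snoc[of ys t] by simp
  qed
qed

text \<open>Letters from \<open>I\<close> leave the coordinates outside \<open>I\<close> alone, and
  such a coordinate cannot be nonnegative both in \<open>b\<close> and in minus its image unless it
  is zero.\<close>

lemma parabolic_inversions:
  assumes "xs \<in> lists I"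
  shows "inversions xs \<subseteq> {b \<in> P. \<forall>i. i \<notin> I \<longrightarrow> b i = 0}"
proof
  fix b assume b: "b \<in> inversions xs"
  have "b i = 0" if "i \<notin> I" for i
    using b P_nonneg[of b i] P_nonneg[of "\<lambda>i. - act xs b i" i] act_outside[OF assms that, of b]
    by (simp add: inversions_def)
  then show "b \<in> {b \<in> P. \<forall>i. i \<notin> I \<longrightarrow> b i = 0}"
    using b by (simp add: inversions_def)
qed

text \<open>\<open>w\<close> inverts every positive root supported on \<open>I\<close>, the most
  that a word over \<open>I\<close> can invert, so its length is maximal. A word of the same length
  inverts the same roots, hence its product with \<open>w\<close> keeps all simple roots positive
  and is trivial. Applied to \<open>w\<close> itself this gives an involution, and then both words
  are the inverse of \<open>w\<close>.\<close>

lemma longest_element_eq: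
  assumes "I \<subseteq> S" "w \<in> lists I" "\<And>i. i \<in> I \<Longrightarrow> act w (alpha i) = (\<lambda>j. - alpha i j)"
  shows "longest_element S m I = cls w"
    and "\<And>x. x \<in> parabolic S m I \<Longrightarrow> coxeter_length x \<le> len w"
    and "cls (w @ w) = cls []"
proof -
  define PI where "PI = {b \<in> P. \<forall>i. i \<notin> I \<longrightarrow> b i = 0}"
  have fin: "finite I" using assms(1) finite_S by (rule finite_subset)
  have sub: "xs \<in> lists S" if "xs \<in> lists I" for xs
    using that assms(1) by auto
  have "act w b = (\<lambda>j. - b j)" if "b \<in> PI" for b
  proof -
    have b: "b = (\<lambda>j. \<Sum>i\<in>I. b i * alpha i j)"
      using that fin by (auto simp: alpha_def PI_def if_distrib cong: if_cong)
    have "act w b = (\<lambda>j. \<Sum>i\<in>I. b i * act w (alpha i) j)"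
      by (subst b) (rule act_sum[OF fin])
    also have "\<dots> = (\<lambda>j. - (\<Sum>i\<in>I. b i * alpha i j))"
      by (simp add: assms(3) sum_negf)
    finally show ?thesis using b by metis
  qed
  then have inv_w: "inversions w = PI"
    using parabolic_inversions[OF assms(2)] by (auto simp: inversions_def PI_def)
  have fin_PI: "finite PI" using finite_P by (simp add: PI_def)
  have le: "len xs \<le> len w" if "xs \<in> lists I" for xs
    using that sub[OF that] sub[OF assms(2)] parabolic_inversions[OF that] fin_PI
    by (simp add: len_eq_card_inversions inv_w PI_def card_mono)
  then show *: "\<And>x. x \<in> parabolic S m I \<Longrightarrow> coxeter_length x \<le> len w"
    by (auto simp: parabolic_eq[OF assms(1)])
  have cancel: "cls (xs @ w) = cls []" if "xs \<in> lists I" "len xs = len w" for xs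
  proof (rule cls_eq_NilI)
    have inv: "inversions xs = PI"
      using that sub[OF that(1)] sub[OF assms(2)] parabolic_inversions[OF that(1)] fin_PI
      by (intro card_subset_eq) (simp_all add: len_eq_card_inversions inv_w flip: PI_def)
    fix s assume "s \<in> S"
    show "\<exists>i. 0 < act (xs @ w) (alpha s) i"
    proof (cases "s \<in> I")
      case True
      then have "alpha s \<in> PI"
        using alpha_in_P \<open>s \<in> S\<close> by (auto simp: PI_def alpha_def)
      then have *: "act (xs @ w) (alpha s) \<in> P"
        using assms(3)[OF True] inv by (auto simp: inversions_def act_minus)
      then have "act (xs @ w) (alpha s) \<noteq> (\<lambda>i. 0)"
        using P_nonzero by auto
      then show ?thesis
        using P_nonneg[OF *] by (metis ext less_eq_real_def)
    next
      case False
      \<comment> \<open>For \<open>s\<close> outside \<open>I\<close> the coordinate at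
        \<open>s\<close> is never touched.\<close>
      then have "act (xs @ w) (alpha s) s = 1"
        using act_outside[of "xs @ w" I s "alpha s"] that assms by (simp add: alpha_def)
      then show ?thesis by (intro exI[of _ s]) simp
    qed
  qed (use that sub assms in auto)
  show "cls (w @ w) = cls []"
    using cancel[OF assms(2)] by simp
  have unique: "cls xs = cls w" if "xs \<in> lists I" "len xs = len w" for xs
  proof -
    have "act xs (act w v) = v" "act w (act w v) = v" for v
      using cancel[OF that] cancel[OF assms(2)] that sub assms(2)
        cls_eq_iff_act[of "xs @ w" "[]"] cls_eq_iff_act[of "w @ w" "[]"] by auto
    then have "act xs v = act w v" for v by metis
    then show ?thesis
      using that sub assms(2) by (intro faithful) auto
  qed
  show "longest_element S m I = cls w"
    unfolding longest_element_def
  proof (rule the_equality)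
    show "cls w \<in> parabolic S m I \<and> (\<forall>v\<in>parabolic S m I. coxeter_length v \<le> len w)"
      using * assms by (auto simp: parabolic_eq)
    fix x assume "x \<in> parabolic S m I \<and> (\<forall>v\<in>parabolic S m I. coxeter_length v \<le> coxeter_length x)"
    then have "x \<in> cls ` lists I" "\<forall>ys\<in>lists I. len ys \<le> coxeter_length x"
      by (simp_all add: parabolic_eq[OF assms(1)])
    then obtain xs where "xs \<in> lists I" "x = cls xs" "len w \<le> len xs"
      using assms(2) by blast
    then show "x = cls w"
      using unique le[of xs] by simp
  qed
qed

subsection \<open>Involutions and the roots they negate\<close>

definition involutive :: "'a list \<Rightarrow> bool" where
  "involutive xs \<longleftrightarrow> xs \<in> lists S \<and> (\<forall>v. act xs (act xs v) = v)"

lemma ex_negated_root: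
  assumes "involutive xs" "cls xs \<noteq> cls []"
  shows "\<exists>b\<in>P. act xs b = (\<lambda>i. - b i)"
  using assms
proof (induction "len xs" arbitrary: xs rule: less_induct)
  case less
  then have xs: "xs \<in> lists S" and inv: "\<And>v. act xs (act xs v) = v"
    by (auto simp: involutive_def)
  obtain ys s where ys: "ys \<in> lists S" "s \<in> S" "cls xs = cls (ys @ [s])" "len xs = len ys + 1"
    using ex_descent xs less.prems(2) by metis
  have "cls (xs @ [s]) = cls ys"
    using cls_append_cong[OF ys(3), of "[s]" "[s]"] cls_cancel[of ys "[]" s] ys xs by simp
  then have lt: "len (xs @ [s]) < len xs"
    using ys by simp
  then have neg: "act xs (alpha s) \<notin> P"
    using act_alpha_in_P_iff[OF xs ys(2)] by simp
  define c where "c = (\<lambda>i. - act xs (alpha s) i)"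
  have c: "c \<in> P"
    unfolding c_def using neg act_P[OF xs] alpha_in_P[OF ys(2)] by blast
  show ?case
  proof (cases "c = alpha s")
    case True
    then have "act xs (alpha s) i = - alpha s i" for i
      by (simp add: c_def fun_eq_iff eq_commute minus_equation_iff)
    then show ?thesis using alpha_in_P[OF ys(2)] by auto
  next
    case False
    \<comment> \<open>Since \<open>c\<close> is a positive root other than \<open>alpha s\<close>,
      the reflection in \<open>s\<close> keeps it positive. Multiplying by \<open>s\<close> on the
      right therefore shortens \<open>s # xs\<close>, and conjugation by \<open>s\<close> lowers the
      length.\<close>
    let ?z = "s # xs @ [s]"
    have z: "?z \<in> lists S" using xs ys by simp
    have "act (s # xs) (alpha s) = (\<lambda>i. - refl s c i)"
      using act_minus[of "[s]" c] by (simp add: c_def)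
    then have "act (s # xs) (alpha s) \<notin> P"
      using refl_P[OF c ys(2) False] not_both_P by force
    then have "len ?z < len (s # xs)"
      using act_alpha_in_P_iff[of "s # xs" s] len_snoc[of "s # xs" s] xs ys by auto
    \<comment> \<open>An involution is its own inverse, so a right descent is also a left
      descent.\<close>
    also have "len (s # xs) = len (rev (xs @ [s]))"
    proof -
      have "cls xs = cls (rev xs)"
        using xs inv act_rev(1)[OF xs] by (subst cls_eq_iff_act) (auto, metis)
      then have "cls (s # xs) = cls (s # rev xs)"
        using cls_append_cong[of "[s]" "[s]" xs "rev xs"] xs ys by simp
      then show ?thesis by simp
    qed
    also have "\<dots> < len xs"
      using lt len_rev[of "xs @ [s]"] xs ys by simp
    finally have "len ?z < len xs" .
    moreover have "involutive ?z"
      using z by (simp add: involutive_def refl_refl inv ys)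
    moreover have "cls ?z \<noteq> cls []"
    proof
      assume "cls ?z = cls []"
      then have "refl s (act xs (refl s v)) = v" for v
        using z cls_eq_iff_act[of ?z "[]"] by simp
      from this[of "refl s _"] have "refl s (act xs v) = refl s v" for v
        using refl_refl[OF ys(2)] by simp
      then have "act xs v = v" for v
        using refl_refl[OF ys(2)] by metis
      then show False
        using less.prems(2) xs cls_eq_iff_act[of xs "[]"] by simp
    qed
    ultimately obtain b where b: "b \<in> P" "act ?z b = (\<lambda>i. - b i)"
      using less.hyps by blast
    have "act xs (refl s b) = refl s (act ?z b)"
      using refl_refl[OF ys(2)] by simp
    also have "\<dots> = (\<lambda>i. - refl s b i)"
      using act_minus[of "[s]" b] b by simp
    finally have *: "act xs (refl s b) = (\<lambda>i. - refl s b i)" .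
    show ?thesis
    proof (cases "b = alpha s")
      case True
      \<comment> \<open>In this case \<open>refl s b\<close> is \<open>-alpha s\<close>, which lies
        outside \<open>P\<close>; the same equation shows that \<open>alpha s\<close> itself is
        negated.\<close>
      have "- act xs (alpha s) i = alpha s i" for i
        using fun_cong[OF *[unfolded True refl_alpha[OF ys(2)] act_minus], of i] by simp
      then have "act xs (alpha s) i = - alpha s i" for i
        by (metis minus_minus)
      then have "act xs (alpha s) = (\<lambda>i. - alpha s i)"
        by blast
      then show ?thesis using alpha_in_P[OF ys(2)] by blast
    next
      case False
      then show ?thesis using * refl_P[OF b(1) ys(2)] by blast
    qed
  qed
qed

definition negated :: "'a list \<Rightarrow> ('a \<Rightarrow> real) set" where
  "negated xs = {b \<in> P. act xs b = (\<lambda>i. - b i)}"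

text \<open>The conjugating element carries negated roots to negated roots up to sign, and
  \<open>f\<close> picks the positive root of each pair. The reverse inequality comes from the
  symmetry of conjugacy.\<close>

lemma card_negated_cong:
  assumes "conjugate xs ys" "xs \<in> lists S" "ys \<in> lists S"
  shows "card (negated xs) = card (negated ys)"
proof -
  have "card (negated xs) \<le> card (negated ys)"
    if conj: "conjugate xs ys" and xs: "xs \<in> lists S" and ys: "ys \<in> lists S" for xs ys
  proof -
    obtain g where g: "g \<in> lists S" "\<And>v. act g (act xs v) = act ys (act g v)"
      using conjugateE[OF conj xs ys] by metis
    define f where "f = (\<lambda>b. if act g b \<in> P then act g b else (\<lambda>i. - act g b i))"
    have "inj_on f (negated xs)"
    proof
      fix b c assume bc: "b \<in> negated xs" "c \<in> negated xs" "f b = f c"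
      have "act g b = act g c \<or> act g b = (\<lambda>i. - act g c i)"
        using bc(3) by (auto simp: f_def fun_eq_iff split: if_splits) (metis minus_minus)+
      then have "act (rev g) (act g b) = act (rev g) (act g c)
          \<or> act (rev g) (act g b) = (\<lambda>i. - act (rev g) (act g c) i)"
        by (auto simp: act_minus)
      then have "b = c \<or> b = (\<lambda>i. - c i)"
        by (simp add: act_rev(1)[OF g(1)])
      then show "b = c"
        using bc not_both_P by (auto simp: negated_def)
    qed
    moreover have "f ` negated xs \<subseteq> negated ys"
    proof
      fix c assume "c \<in> f ` negated xs"
      then obtain b where b: "b \<in> P" "act xs b = (\<lambda>i. - b i)" "c = f b"
        by (auto simp: negated_def)
      have "act ys (act g b) = (\<lambda>i. - act g b i)"
        using g(2)[of b] by (simp add: b(2) act_minus)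
      then show "c \<in> negated ys"
        using act_P[OF g(1) b(1)] by (auto simp: b(3) negated_def f_def act_minus)
    qed
    moreover have "finite (negated ys)"
      using finite_P by (simp add: negated_def)
    ultimately show ?thesis by (rule card_inj_on_le)
  qed
  then show ?thesis
    using assms conjugate_sym by (intro antisym) blast+
qed

text \<open>\<open>splits xs \<Theta> r\<close>: up to conjugation, the product \<open>r\<close> of the reflections in the roots \<open>\<Theta>\<close> has
  been divided out of \<open>xs\<close>; what remains is an involution \<open>z\<close> fixing \<open>\<Theta>\<close>, and conjugating \<open>z\<close> by
  elements fixing \<open>\<Theta>\<close> does not disturb \<open>r\<close>.\<close>

definition centralizing :: "('a \<Rightarrow> real) set \<Rightarrow> 'a list \<Rightarrow> bool" where
  "centralizing \<Theta> r \<longleftrightarrow> r \<in> lists S \<and>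
    (\<forall>g\<in>lists S. (\<forall>b\<in>\<Theta>. act g b = b) \<longrightarrow> (\<forall>v. act g (act r v) = act r (act g v)))"

definition splits :: "'a list \<Rightarrow> ('a \<Rightarrow> real) set \<Rightarrow> 'a list \<Rightarrow> bool" where
  "splits xs \<Theta> r \<longleftrightarrow> centralizing \<Theta> r \<and>
    (\<exists>z. involutive z \<and> (\<forall>b\<in>\<Theta>. act z b = b) \<and> conjugate xs (z @ r))"

lemma splits_empty: "involutive xs \<Longrightarrow> splits xs {} []"
  using conjugate_refl[of xs] by (auto simp: splits_def centralizing_def)

lemma centralizing_insert:
  assumes "centralizing \<Theta> r" "reflection_word q b"
  shows "centralizing (insert b \<Theta>) (q @ r)"
  using assms reflection_word_commutes[OF assms(2)]
  by (auto simp: centralizing_def reflection_word_def)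

text \<open>\<open>T\<close> plays the role of the dominant roots for \<open>W\<^sub>J\<close> among the roots orthogonal to \<open>\<Theta>\<close>: a root of
  maximal height in its \<open>W\<^sub>J\<close>-orbit lies in \<open>T\<close>.\<close>

lemma ascend_negated_root:
  assumes z: "z \<in> lists S" "b \<in> P" "act z b = (\<lambda>i. - b i)" "\<forall>t\<in>\<Theta>. act z t = t"
    and J: "J \<subseteq> S" "\<forall>j\<in>J. \<forall>t\<in>\<Theta>. refl j t = t"
    and T: "\<And>c. c \<in> P \<Longrightarrow> \<forall>t\<in>\<Theta>. form c t = 0 \<Longrightarrow> c \<in> T \<or> (\<exists>j\<in>J. pairing j c < 0)"
  shows "\<exists>g\<in>lists J. act g b \<in> T"
proof -
  define height where "height = (\<lambda>c::'a \<Rightarrow> real. \<Sum>i\<in>S. c i)"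
  define X where "X = {c \<in> P. \<exists>g\<in>lists J. c = act g b}"
  have "b \<in> X" using z by (auto simp: X_def intro!: bexI[of _ "[]"])
  moreover have "finite X" using finite_P by (simp add: X_def)
  ultimately obtain c where c: "c \<in> X" "\<And>d. d \<in> X \<Longrightarrow> height d \<le> height c"
    using obtains_MAX[of X height] by (metis Max_ge empty_iff finite_imageI image_eqI)
  then obtain g where g: "g \<in> lists J" "c = act g b" by (auto simp: X_def)
  have gS: "g \<in> lists S" using g J by auto
  have "form c t = 0" if "t \<in> \<Theta>" for t
  proof -
    have "act g t = t"
      using g(1) J that by (induction g) auto
    then have "form c t = form b t"
      using form_act[OF gS, of b t] g by simp
    then show ?thesis
      using form_zero_if_negated[of z b t] z that by simp
  qed
  then have "c \<in> T \<or> (\<exists>j\<in>J. pairing j c < 0)"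
    using T c by (simp add: X_def)
  moreover have "\<not> pairing j c < 0" if "j \<in> J" for j
  proof
    assume neg: "pairing j c < 0"
    have j: "j \<in> S" using that J by auto
    have "c \<noteq> alpha j"
      using neg j by (auto simp: pairing_alpha cartan_def)
    then have "refl j c \<in> X"
      using c g that j refl_P by (auto simp: X_def intro!: bexI[of _ "j # g"])
    moreover have "(\<Sum>i\<in>S. pairing j c * alpha j i) = pairing j c"
      using j finite_S by (simp add: alpha_def if_distrib cong: if_cong)
    then have "height (refl j c) = height c - pairing j c"
      by (simp add: height_def refl_apply sum_subtractf)
    ultimately show False using c(2)[of "refl j c"] neg by simp
  qed
  ultimately show ?thesis using g by blast
qed

text \<open>If the remaining involution is nontrivial, it negates a root, which a word over
  \<open>J\<close> moves into \<open>T\<close>. That word fixes \<Theta>, so conjugating by it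
  leaves \<open>r\<close> intact; the reflection in the new root is then moved from the involution
  to \<open>r\<close>.\<close>

lemma splits_step:
  assumes x: "splits x \<Theta> r"
    and J: "J \<subseteq> S" "\<forall>j\<in>J. \<forall>t\<in>\<Theta>. refl j t = t"
    and T: "\<And>c. c \<in> P \<Longrightarrow> \<forall>t\<in>\<Theta>. form c t = 0 \<Longrightarrow> c \<in> fst ` T \<or> (\<exists>j\<in>J. pairing j c < 0)"
    and q: "\<And>t q. (t, q) \<in> T \<Longrightarrow> reflection_word q t"
    and xS: "x \<in> lists S"
  shows "conjugate x r \<or> (\<exists>(t, q)\<in>T. splits x (insert t \<Theta>) (q @ r))"
proof -
  obtain z where z: "involutive z" "\<forall>t\<in>\<Theta>. act z t = t" "conjugate x (z @ r)"
    and r: "centralizing \<Theta> r"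
    using x by (auto simp: splits_def)
  have zS: "z \<in> lists S" and zz: "\<And>v. act z (act z v) = v" and rS: "r \<in> lists S"
    using z r by (auto simp: involutive_def centralizing_def)
  show ?thesis
  proof (cases "cls z = cls []")
    case True
    then have "cls (z @ r) = cls r"
      using cls_append_cong[of z "[]" r r] zS rS by simp
    then show ?thesis using z by (simp add: conjugate_def)
  next
    case False
    then obtain b where b: "b \<in> P" "act z b = (\<lambda>i. - b i)"
      using ex_negated_root z by blast
    obtain g where g: "g \<in> lists J" "act g b \<in> fst ` T"
      using ascend_negated_root[OF zS b z(2) J T] by blast
    then obtain q where tq: "(act g b, q) \<in> T" by force
    define t where "t = act g b"
    have rq: "reflection_word q t" using q tq by (simp add: t_def)
    then have qS: "q \<in> lists S" by (simp add: reflection_word_def)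
    have gS: "g \<in> lists S" using g J by auto
    have g\<Theta>: "\<forall>t\<in>\<Theta>. act g t = t"
      using g(1) J by (induction g) auto
    then have g'\<Theta>: "\<forall>t\<in>\<Theta>. act (rev g) t = t"
      using act_rev(1)[OF gS] by metis
    define y where "y = g @ z @ rev g"
    have yS: "y \<in> lists S" using gS zS by (simp add: y_def)
    have yy: "act y (act y v) = v" for v
      using gS zz by (simp add: y_def act_rev)
    have yt: "act y t = (\<lambda>i. - t i)"
      using gS b by (simp add: y_def t_def act_rev act_minus)
    have y\<Theta>: "\<forall>t\<in>\<Theta>. act y t = t"
      using z(2) g\<Theta> g'\<Theta> by (simp add: y_def)
    have yq: "act y (act q v) = act q (act y v)" for v
      using reflection_word_commutes[OF rq yS] yt by simp
    have "involutive (y @ q)"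
      using yS qS reflection_word_involutive[OF rq] yy by (simp add: involutive_def yq)
    moreover have "act (y @ q) u = u" if "u \<in> insert t \<Theta>" for u
    proof (cases "u = t")
      case True
      then show ?thesis
        using reflection_word_negates[OF rq] yt by (simp add: act_minus)
    next
      case False
      then have "form u t = 0"
        using form_zero_if_negated[OF yS yt, of u] y\<Theta> that form_sym[of u t] by simp
      then show ?thesis
        using False that reflection_word_fixes[OF rq] y\<Theta> by simp
    qed
    moreover have "conjugate (z @ r) ((y @ q) @ (q @ r))"
    \<comment> \<open>The two copies of \<open>q\<close> cancel and leave \<open>y @ r\<close>,
      while \<open>g\<close> passes \<open>r\<close> because it fixes \<Theta>.\<close>
    proof (rule conjugateI[OF gS])
      have "act g (act r v) = act r (act g v)" for v
        using r gS g\<Theta> by (auto simp: centralizing_def)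
      then show "act g (act (z @ r) v) = act ((y @ q) @ q @ r) (act g v)" for v
        using gS reflection_word_involutive[OF rq]
        by (simp add: y_def act_rev flip: \<open>\<And>v. act g (act r v) = act r (act g v)\<close>)
    qed (use yS qS zS rS in auto)
    then have "conjugate x ((y @ q) @ (q @ r))"
      using z(3) conjugate_trans xS zS rS yS qS by (metis append_in_lists_conv)
    ultimately have "splits x (insert t \<Theta>) (q @ r)"
      using centralizing_insert[OF r rq] by (auto simp: splits_def)
    then show ?thesis using tq by (auto simp: t_def)
  qed
qed

text \<open>Strip the letters of \<open>K\<close> one at a time. If \<open>alpha k\<close> is
  negated, \<open>k # z\<close> is an involution fixing \<open>alpha k\<close>; whatever it negates
  is orthogonal to \<open>alpha k\<close>, hence is negated by \<open>z\<close> as well, and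
  \<open>K\<close> without \<open>k\<close> suffices. With no letters left, nothing is negated and
  the involution is trivial.\<close>

lemma involutive_eq_subseq:
  assumes "involutive z" "set K \<subseteq> S" "\<And>b. b \<in> P \<Longrightarrow> act z b = (\<lambda>i. - b i) \<Longrightarrow> b \<in> alpha ` set K"
  shows "\<exists>ws\<in>set (subseqs K). cls z = cls ws"
  using assms
proof (induction K arbitrary: z)
  case Nil
  then show ?case using ex_negated_root by auto
next
  case (Cons k K)
  have zS: "z \<in> lists S" and zz: "\<And>v. act z (act z v) = v" and k: "k \<in> S"
    using Cons.prems by (auto simp: involutive_def)
  show ?case
  proof (cases "act z (alpha k) = (\<lambda>i. - alpha k i)")
    case True
    have zk: "act z (refl k v) = refl k (act z v)" for v
      using reflection_word_commutes[OF reflection_word_simple[OF k] zS] True by simp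
    have fix_k: "act (k # z) (alpha k) = alpha k"
      using True refl_alpha[OF k] act_minus[of "[k]" "alpha k"] by simp
    have "\<exists>ws\<in>set (subseqs K). cls (k # z) = cls ws"
    proof (rule Cons.IH)
      show "involutive (k # z)"
        using zS k by (simp add: involutive_def zk zz refl_refl)
      show "set K \<subseteq> S" using Cons.prems by simp
      fix b assume b: "b \<in> P" "act (k # z) b = (\<lambda>i. - b i)"
      then have "form b (alpha k) = 0"
        using form_zero_if_negated[of "k # z" b "alpha k"] fix_k zS k by simp
      then have "refl k b = b"
        using reflection_word_fixes[OF reflection_word_simple[OF k]] by simp
      then have "act z b = (\<lambda>i. - b i)"
        using b by (simp add: zk[symmetric])
      then have "b \<in> alpha ` set (k # K)"
        using Cons.prems b by blast
      moreover have "b \<noteq> alpha k"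
        using b fix_k not_both_P[of b] by auto
      ultimately show "b \<in> alpha ` set K" by auto
    qed
    then obtain ws where ws: "ws \<in> set (subseqs K)" "cls (k # z) = cls ws" by blast
    have "ws \<in> lists S"
      using ws(1) Cons.prems(2) subseqs_powset[of K] by auto
    then have "cls (k # k # z) = cls (k # ws)"
      using cls_append_cong[of "[k]" "[k]" "k # z" ws] ws zS k by simp
    then have "cls z = cls (k # ws)"
      using cls_cancel[of "[]" z k] zS k by simp
    then show ?thesis using ws by (auto simp: Let_def)
  next
    case False
    then have "\<exists>ws\<in>set (subseqs K). cls z = cls ws"
      using Cons.prems by (intro Cons.IH) auto
    then show ?thesis by (auto simp: Let_def)
  qed
qed

lemma splits_final:
  assumes "splits x \<Theta> r" "set K \<subseteq> S"
    "\<And>c. c \<in> P \<Longrightarrow> \<forall>t\<in>\<Theta>. form c t = 0 \<Longrightarrow> c \<in> alpha ` set K"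
  shows "\<exists>ws\<in>set (subseqs K). conjugate x (ws @ r)"
proof -
  obtain z where z: "involutive z" "\<forall>t\<in>\<Theta>. act z t = t" "conjugate x (z @ r)"
    and r: "r \<in> lists S"
    using assms(1) by (auto simp: splits_def centralizing_def)
  have zS: "z \<in> lists S" using z by (simp add: involutive_def)
  have "\<exists>ws\<in>set (subseqs K). cls z = cls ws"
    using assms z form_zero_if_negated[OF zS] by (intro involutive_eq_subseq) auto
  then obtain ws where ws: "ws \<in> set (subseqs K)" "cls z = cls ws" by blast
  have "ws \<in> lists S"
    using ws(1) assms(2) subseqs_powset[of K] by auto
  then have "cls (z @ r) = cls (ws @ r)"
    using ws zS r by (intro cls_append_cong) auto
  then show ?thesis using z ws by (auto simp: conjugate_def)
qed

end

section \<open>Type \<open>E\<^sub>8\<close>\<close>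

subsection \<open>Coordinates\<close>

text \<open>Otherwise simp turns \<^term>\<open>E8_nodes\<close> into \<open>{Suc 0..8}\<close> and the facts about it no longer apply.\<close>

declare One_nat_def [simp del]

text \<open>A simple reflection replaces its own coordinate by the sum of the adjacent ones minus
  itself. The cases are spelled out so that explicit lists are evaluated by rewriting.\<close>

definition lrefl :: "nat \<Rightarrow> int list \<Rightarrow> int list" where
  "lrefl s v = (case v of [a, b, c, d, e, f, g, h] \<Rightarrow>
     if s = 1 then [c - a, b, c, d, e, f, g, h] else
     if s = 2 then [a, d - b, c, d, e, f, g, h] else
     if s = 3 then [a, b, a + d - c, d, e, f, g, h] else
     if s = 4 then [a, b, c, b + c + e - d, e, f, g, h] else
     if s = 5 then [a, b, c, d, d + f - e, f, g, h] else
     if s = 6 then [a, b, c, d, e, e + g - f, g, h] else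
     if s = 7 then [a, b, c, d, e, f, f + h - g, h] else [a, b, c, d, e, f, g, g - h])"

lemma lrefl_simps:
  "lrefl 1 [a, b, c, d, e, f, g, h] = [c - a, b, c, d, e, f, g, h]"
  "lrefl 2 [a, b, c, d, e, f, g, h] = [a, d - b, c, d, e, f, g, h]"
  "lrefl 3 [a, b, c, d, e, f, g, h] = [a, b, a + d - c, d, e, f, g, h]"
  "lrefl 4 [a, b, c, d, e, f, g, h] = [a, b, c, b + c + e - d, e, f, g, h]"
  "lrefl 5 [a, b, c, d, e, f, g, h] = [a, b, c, d, d + f - e, f, g, h]"
  "lrefl 6 [a, b, c, d, e, f, g, h] = [a, b, c, d, e, e + g - f, g, h]"
  "lrefl 7 [a, b, c, d, e, f, g, h] = [a, b, c, d, e, f, f + h - g, h]"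
  "lrefl 8 [a, b, c, d, e, f, g, h] = [a, b, c, d, e, f, g, g - h]"
  by (simp_all add: lrefl_def)

definition lact :: "nat list \<Rightarrow> int list \<Rightarrow> int list" where
  "lact xs v = foldr lrefl xs v"

text \<open>The reflection subtracts the pairing from coordinate \<open>s\<close>, so the pairing is
  read off as a difference.\<close>

definition lpairing :: "nat \<Rightarrow> int list \<Rightarrow> int" where
  "lpairing s v = v ! (s - 1) - lrefl s v ! (s - 1)"

definition lform :: "int list \<Rightarrow> int list \<Rightarrow> int" where
  "lform v w = (\<Sum>s\<leftarrow>[1,2,3,4,5,6,7,8]. v ! (s - 1) * lpairing s w)"

definition unit :: "nat \<Rightarrow> int list" where
  "unit s = map (\<lambda>i. if i = s then 1 else 0) [1,2,3,4,5,6,7,8]"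

definition units :: "int list list" where
  "units = map unit [1,2,3,4,5,6,7,8]"

lemma unit_simps:
  "unit 1 = [1,0,0,0,0,0,0,0]"
  "unit 2 = [0,1,0,0,0,0,0,0]" "unit 3 = [0,0,1,0,0,0,0,0]"
  "unit 4 = [0,0,0,1,0,0,0,0]" "unit 5 = [0,0,0,0,1,0,0,0]"
  "unit 6 = [0,0,0,0,0,1,0,0]" "unit 7 = [0,0,0,0,0,0,1,0]"
  "unit 8 = [0,0,0,0,0,0,0,1]"
  by (simp_all add: unit_def)

lemma units_simps:
  "units = [[1,0,0,0,0,0,0,0], [0,1,0,0,0,0,0,0], [0,0,1,0,0,0,0,0], [0,0,0,1,0,0,0,0],
    [0,0,0,0,1,0,0,0], [0,0,0,0,0,1,0,0], [0,0,0,0,0,0,1,0], [0,0,0,0,0,0,0,1]]"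
  by (simp add: units_def unit_simps)

lemma lpairing_simps:
  "lpairing 1 [a, b, c, d, e, f, g, h] = 2 * a - c"
  "lpairing 2 [a, b, c, d, e, f, g, h] = 2 * b - d"
  "lpairing 3 [a, b, c, d, e, f, g, h] = 2 * c - a - d"
  "lpairing 4 [a, b, c, d, e, f, g, h] = 2 * d - b - c - e"
  "lpairing 5 [a, b, c, d, e, f, g, h] = 2 * e - d - f"
  "lpairing 6 [a, b, c, d, e, f, g, h] = 2 * f - e - g"
  "lpairing 7 [a, b, c, d, e, f, g, h] = 2 * g - f - h"
  "lpairing 8 [a, b, c, d, e, f, g, h] = 2 * h - g"
  by (simp_all add: lpairing_def lrefl_simps)

lemma lform_simps:
  "lform [a, b, c, d, e, f, g, h] [a', b', c', d', e', f', g', h'] =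
    a * (2 * a' - c') + b * (2 * b' - d') + c * (2 * c' - a' - d') + d * (2 * d' - b' - c' - e') +
    e * (2 * e' - d' - f') + f * (2 * f' - e' - g') + g * (2 * g' - f' - h') + h * (2 * h' - g')"
  by (simp add: lform_def lpairing_simps)

lemma length_8_cases:
  assumes "length v = 8"
  obtains a b c d e f g h where "v = [a, b, c, d, e, f, g, h]"
  using assms by (auto simp: numeral_eq_Suc length_Suc_conv)

lemma E8_nodes_eq: "E8_nodes = {1, 2, 3, 4, 5, 6, 7, 8}"
  by auto

lemma E8_node_cases:
  assumes "s \<in> E8_nodes"
  obtains "s = 1" | "s = 2" | "s = 3" | "s = 4" | "s = 5" | "s = 6" | "s = 7" | "s = 8"
  using assms unfolding E8_nodes_eq by blast

interpretation E8: simply_laced E8_nodes E8_matrix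
  by unfold_locales (auto simp: E8_matrix_def insert_commute)

definition vec :: "int list \<Rightarrow> nat \<Rightarrow> real" where
  "vec v i = (if i \<in> E8_nodes then of_int (v ! (i - 1)) else 0)"

lemma vec_simps:
  "vec [a, b, c, d, e, f, g, h] 1 = a"
  "vec [a, b, c, d, e, f, g, h] 2 = b"
  "vec [a, b, c, d, e, f, g, h] 3 = c" "vec [a, b, c, d, e, f, g, h] 4 = d"
  "vec [a, b, c, d, e, f, g, h] 5 = e" "vec [a, b, c, d, e, f, g, h] 6 = f"
  "vec [a, b, c, d, e, f, g, h] 7 = g" "vec [a, b, c, d, e, f, g, h] 8 = h"
  by (simp_all add: vec_def)

lemma length_lrefl: "length v = 8 \<Longrightarrow> length (lrefl s v) = 8"
  by (elim length_8_cases) (simp add: lrefl_def)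

lemma length_lact: "length v = 8 \<Longrightarrow> length (lact xs v) = 8"
  by (induction xs) (simp_all add: lact_def length_lrefl)

lemma pairing_vec:
  assumes "s \<in> E8_nodes" "length v = 8"
  shows "E8.pairing s (vec v) = of_int (lpairing s v)"
proof -
  obtain a b c d e f g h where v: "v = [a, b, c, d, e, f, g, h]"
    using assms(2) by (rule length_8_cases)
  have "E8.pairing s (vec v) = (\<Sum>t\<in>{1,2,3,4,5,6,7,8}. E8.cartan s t * vec v t)"
    unfolding E8.pairing_def by (rule sum.cong[OF E8_nodes_eq HOL.refl])
  also have "\<dots> = of_int (lpairing s v)"
    using assms(1) unfolding v
    by (cases s rule: E8_node_cases)
      (simp_all add: vec_simps lpairing_simps E8.cartan_def E8_matrix_def E8_edges_def
        doubleton_eq_iff)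
  finally show ?thesis .
qed

lemma refl_vec:
  assumes "s \<in> E8_nodes" "length v = 8"
  shows "E8.refl s (vec v) = vec (lrefl s v)"
proof
  fix i
  obtain a b c d e f g h where v: "v = [a, b, c, d, e, f, g, h]"
    using assms(2) by (rule length_8_cases)
  show "E8.refl s (vec v) i = vec (lrefl s v) i"
  proof (cases "i = s")
    case True
    then show ?thesis
      using assms by (simp add: E8.refl_apply pairing_vec E8.alpha_def lpairing_def vec_def)
  next
    case False
    have "lrefl s v ! (i - 1) = v ! (i - 1)" if "i \<in> E8_nodes"
      by (rule E8_node_cases[OF assms(1)]; rule E8_node_cases[OF that])
        (use False in \<open>simp_all add: v lrefl_simps\<close>)
    then show ?thesis
      using False by (simp add: E8.refl_apply E8.alpha_def vec_def)
  qed
qed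

lemma act_vec: "xs \<in> lists E8_nodes \<Longrightarrow> length v = 8 \<Longrightarrow> E8.act xs (vec v) = vec (lact xs v)"
proof (induction xs)
  case (Cons s xs)
  then show ?case
    using refl_vec[of s "lact xs v"] length_lact[of v xs] by (simp add: lact_def)
qed (simp add: lact_def)

lemma vec_inject:
  assumes "length v = 8" "length w = 8"
  shows "vec v = vec w \<longleftrightarrow> v = w"
proof
  assume eq: "vec v = vec w"
  show "v = w"
  proof (rule nth_equalityI)
    fix i assume "i < length v"
    then show "v ! i = w ! i"
      using fun_cong[OF eq, of "Suc i"] assms by (simp add: vec_def)
  qed (simp add: assms)
qed simp

lemma vec_uminus: "length v = 8 \<Longrightarrow> vec (map uminus v) = (\<lambda>i. - vec v i)"
  by (rule ext) (auto simp: vec_def)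

lemma alpha_eq_vec:
  assumes "s \<in> E8_nodes"
  shows "E8.alpha s = vec (unit s)"
proof
  fix i
  show "E8.alpha s i = vec (unit s) i"
  proof (cases "i \<in> E8_nodes")
    case True
    show ?thesis
      by (rule E8_node_cases[OF assms]; rule E8_node_cases[OF True])
        (simp_all add: E8.alpha_def unit_simps vec_simps)
  next
    case False
    then show ?thesis using assms by (auto simp: E8.alpha_def vec_def)
  qed
qed

lemma length_unit: "length (unit s) = 8"
  by (simp add: unit_def)

lemma form_vec:
  assumes "length v = 8" "length w = 8"
  shows "E8.form (vec v) (vec w) = of_int (lform v w)"
proof -
  obtain a b c d e f g h where v: "v = [a, b, c, d, e, f, g, h]"
    using assms(1) by (rule length_8_cases)
  have "E8.form (vec v) (vec w) = (\<Sum>s\<in>E8_nodes. vec v s * of_int (lpairing s w))"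
    unfolding E8.form_def by (intro sum.cong HOL.refl) (simp only: pairing_vec[OF _ assms(2)])
  also have "\<dots> = (\<Sum>s\<in>{1,2,3,4,5,6,7,8}. vec v s * of_int (lpairing s w))"
    by (rule sum.cong[OF E8_nodes_eq HOL.refl])
  also have "\<dots> = of_int (lform v w)"
    by (simp add: v vec_simps lform_def)
  finally show ?thesis .
qed

subsection \<open>The root system\<close>

text \<open>Positive roots in simple-root coordinates by increasing height, from the 8 simple roots
  to the highest root of height 29.\<close>

definition roots :: "int list list" where
  "roots =
    [[1,0,0,0,0,0,0,0], [0,1,0,0,0,0,0,0], [0,0,1,0,0,0,0,0], [0,0,0,1,0,0,0,0],
     [0,0,0,0,1,0,0,0], [0,0,0,0,0,1,0,0], [0,0,0,0,0,0,1,0], [0,0,0,0,0,0,0,1],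
     [1,0,1,0,0,0,0,0], [0,1,0,1,0,0,0,0], [0,0,1,1,0,0,0,0], [0,0,0,1,1,0,0,0],
     [0,0,0,0,1,1,0,0], [0,0,0,0,0,1,1,0], [0,0,0,0,0,0,1,1], [1,0,1,1,0,0,0,0],
     [0,1,1,1,0,0,0,0], [0,1,0,1,1,0,0,0], [0,0,1,1,1,0,0,0], [0,0,0,1,1,1,0,0],
     [0,0,0,0,1,1,1,0], [0,0,0,0,0,1,1,1], [1,1,1,1,0,0,0,0], [1,0,1,1,1,0,0,0],
     [0,1,1,1,1,0,0,0], [0,1,0,1,1,1,0,0], [0,0,1,1,1,1,0,0], [0,0,0,1,1,1,1,0],
     [0,0,0,0,1,1,1,1], [1,1,1,1,1,0,0,0], [0,1,1,2,1,0,0,0], [1,0,1,1,1,1,0,0],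
     [0,1,1,1,1,1,0,0], [0,1,0,1,1,1,1,0], [0,0,1,1,1,1,1,0], [0,0,0,1,1,1,1,1],
     [1,1,1,2,1,0,0,0], [1,1,1,1,1,1,0,0], [0,1,1,2,1,1,0,0], [1,0,1,1,1,1,1,0],
     [0,1,1,1,1,1,1,0], [0,1,0,1,1,1,1,1], [0,0,1,1,1,1,1,1], [1,1,2,2,1,0,0,0],
     [1,1,1,2,1,1,0,0], [0,1,1,2,2,1,0,0], [1,1,1,1,1,1,1,0], [0,1,1,2,1,1,1,0],
     [1,0,1,1,1,1,1,1], [0,1,1,1,1,1,1,1], [1,1,2,2,1,1,0,0], [1,1,1,2,2,1,0,0],
     [1,1,1,2,1,1,1,0], [0,1,1,2,2,1,1,0], [1,1,1,1,1,1,1,1], [0,1,1,2,1,1,1,1],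
     [1,1,2,2,2,1,0,0], [1,1,2,2,1,1,1,0], [1,1,1,2,2,1,1,0], [0,1,1,2,2,2,1,0],
     [1,1,1,2,1,1,1,1], [0,1,1,2,2,1,1,1], [1,1,2,3,2,1,0,0], [1,1,2,2,2,1,1,0],
     [1,1,1,2,2,2,1,0], [1,1,2,2,1,1,1,1], [1,1,1,2,2,1,1,1], [0,1,1,2,2,2,1,1],
     [1,2,2,3,2,1,0,0], [1,1,2,3,2,1,1,0], [1,1,2,2,2,2,1,0], [1,1,2,2,2,1,1,1],
     [1,1,1,2,2,2,1,1], [0,1,1,2,2,2,2,1], [1,2,2,3,2,1,1,0], [1,1,2,3,2,2,1,0],
     [1,1,2,3,2,1,1,1], [1,1,2,2,2,2,1,1], [1,1,1,2,2,2,2,1], [1,2,2,3,2,2,1,0],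
     [1,1,2,3,3,2,1,0], [1,2,2,3,2,1,1,1], [1,1,2,3,2,2,1,1], [1,1,2,2,2,2,2,1],
     [1,2,2,3,3,2,1,0], [1,2,2,3,2,2,1,1], [1,1,2,3,3,2,1,1], [1,1,2,3,2,2,2,1],
     [1,2,2,4,3,2,1,0], [1,2,2,3,3,2,1,1], [1,2,2,3,2,2,2,1], [1,1,2,3,3,2,2,1],
     [1,2,3,4,3,2,1,0], [1,2,2,4,3,2,1,1], [1,2,2,3,3,2,2,1], [1,1,2,3,3,3,2,1],
     [2,2,3,4,3,2,1,0], [1,2,3,4,3,2,1,1], [1,2,2,4,3,2,2,1], [1,2,2,3,3,3,2,1],
     [2,2,3,4,3,2,1,1], [1,2,3,4,3,2,2,1], [1,2,2,4,3,3,2,1], [2,2,3,4,3,2,2,1],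
     [1,2,3,4,3,3,2,1], [1,2,2,4,4,3,2,1], [2,2,3,4,3,3,2,1], [1,2,3,4,4,3,2,1],
     [2,2,3,4,4,3,2,1], [1,2,3,5,4,3,2,1], [2,2,3,5,4,3,2,1], [1,3,3,5,4,3,2,1],
     [2,3,3,5,4,3,2,1], [2,2,4,5,4,3,2,1], [2,3,4,5,4,3,2,1], [2,3,4,6,4,3,2,1],
     [2,3,4,6,5,3,2,1], [2,3,4,6,5,4,2,1], [2,3,4,6,5,4,3,1], [2,3,4,6,5,4,3,2]]"

definition root_set :: "int list set" where
  "root_set = set roots"

text \<open>As 120 separate rewrite rules, membership in the root system is decided by term indexing.\<close>

lemma roots_in_root_set: "list_all (\<lambda>v. v \<in> root_set) roots"
  by (simp add: list_all_iff root_set_def)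

lemmas in_root_set = roots_in_root_set[unfolded roots_def list.pred_inject simp_thms]

lemma root_cases:
  assumes "v \<in> root_set" "list_all Q roots"
  shows "Q v"
  using assms by (simp add: root_set_def list_all_iff)

lemma roots_nonneg: "list_all (\<lambda>v. length v = 8 \<and> list_all (\<lambda>x. 0 \<le> x) v \<and> list_ex (\<lambda>x. x \<noteq> 0) v) roots"
  by (simp add: roots_def)

lemma roots_closed:
  "list_all (\<lambda>v. list_all (\<lambda>s. v = unit s \<or> lrefl s v \<in> root_set) [1,2,3,4,5,6,7,8]) roots"
  by (simp add: in_root_set lrefl_simps unit_simps roots_def)

lemma units_are_roots: "list_all (\<lambda>v. v \<in> root_set) units"
  by (simp add: units_simps in_root_set)

lemma distinct_roots: "distinct roots"
  by (simp add: roots_def)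

interpretation E8: simply_laced_finite E8_nodes E8_matrix "vec ` root_set"
proof unfold_locales
  show "finite (vec ` root_set)"
    by (simp add: root_set_def)
  fix b i assume "b \<in> vec ` root_set"
  then obtain v where v: "v \<in> root_set" "b = vec v" by blast
  note nn = root_cases[OF v(1) roots_nonneg]
  show "0 \<le> b i"
    using nn by (auto simp: v vec_def list_all_length)
  show "b i = 0" if "i \<notin> E8_nodes"
    using that unfolding v vec_def by (rule if_not_P)
  show "E8.refl s b \<in> vec ` root_set" if "s \<in> E8_nodes" "b \<noteq> E8.alpha s" for s
  proof -
    have "v = unit s \<or> lrefl s v \<in> root_set"
      using that(1) root_cases[OF v(1) roots_closed] unfolding E8_nodes_eq by auto
    then show ?thesis
      using that nn refl_vec[of s v] by (auto simp: v alpha_eq_vec)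
  qed
next
  show "E8.alpha s \<in> vec ` root_set" if "s \<in> E8_nodes" for s
  proof -
    have "unit s \<in> root_set"
      using that units_are_roots unfolding E8_nodes_eq units_def by auto
    then show ?thesis using that by (simp add: alpha_eq_vec)
  qed
next
  show "(\<lambda>i. 0) \<notin> vec ` root_set"
  proof
    assume "(\<lambda>i. 0) \<in> vec ` root_set"
    then obtain v where v: "v \<in> root_set" "vec v = (\<lambda>i. 0)" by auto
    note nn = root_cases[OF v(1) roots_nonneg]
    then obtain k where k: "k < 8" "v ! k \<noteq> 0"
      by (auto simp: list_ex_length)
    then show False
      using fun_cong[OF v(2), of "Suc k"] by (simp add: vec_def)
  qed
qed

lemma root_length: "v \<in> root_set \<Longrightarrow> length v = 8"
  using root_cases[OF _ roots_nonneg] by blast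

subsection \<open>Orthogonal systems of roots\<close>

lemma reflection_word_lact:
  assumes "u \<in> lists E8_nodes" "s \<in> E8_nodes" "lact u (unit s) = t"
  shows "E8.reflection_word (u @ [s] @ rev u) (vec t)"
  using E8.reflection_word_conj[OF assms(1,2)] act_vec[OF assms(1) length_unit, of s] assms
  by (simp add: alpha_eq_vec)

lemma orthogonal_vec:
  assumes "\<forall>t\<in>vec ` set \<Theta>. E8.form (vec v) t = 0" "list_all (\<lambda>t. length t = 8) \<Theta>" "length v = 8"
  shows "list_all (\<lambda>t. lform v t = 0) \<Theta>"
  using assms by (auto simp: list_all_iff form_vec)

text \<open>\<open>splits_step\<close> as an evaluation over \<open>roots\<close>: each listed root
  orthogonal to \<Theta> is a target in \<open>T\<close> or can be raised by a letter of
  \<open>J\<close>.\<close>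

lemma splits_check:
  assumes "E8.splits x (vec ` set \<Theta>) r" "x \<in> lists E8_nodes" "J \<in> lists E8_nodes"
    "list_all (\<lambda>t. length t = 8) \<Theta>"
    "list_all (\<lambda>j. list_all (\<lambda>t. lrefl j t = t) \<Theta>) J"
    "list_all (\<lambda>(t, q). E8.reflection_word q (vec t)) T"
    "list_all (\<lambda>v. list_all (\<lambda>t. lform v t = 0) \<Theta> \<longrightarrow>
       v \<in> set (map fst T) \<or> list_ex (\<lambda>j. lpairing j v < 0) J) roots"
  shows "E8.conjugate x r \<or> list_ex (\<lambda>(t, q). E8.splits x (vec ` set (t # \<Theta>)) (q @ r)) T"
proof -
  let ?T = "(\<lambda>(t, q). (vec t, q)) ` set T"
  have "E8.conjugate x r \<or> (\<exists>(t, q)\<in>?T. E8.splits x (insert t (vec ` set \<Theta>)) (q @ r))"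
  proof (rule E8.splits_step[OF assms(1), of "set J"])
    show "set J \<subseteq> E8_nodes" using assms(3) by auto
    show "\<forall>j\<in>set J. \<forall>t\<in>vec ` set \<Theta>. E8.refl j t = t"
      using assms(3,4,5) by (auto simp: list_all_iff refl_vec)
    show "E8.reflection_word q t" if "(t, q) \<in> ?T" for t q
      using that assms(6) by (auto simp: list_all_iff)
    fix c assume "c \<in> vec ` root_set" "\<forall>t\<in>vec ` set \<Theta>. E8.form c t = 0"
    then obtain v where v: "v \<in> root_set" "c = vec v" "\<forall>t\<in>vec ` set \<Theta>. E8.form (vec v) t = 0"
      by blast
    then have "v \<in> set (map fst T) \<or> list_ex (\<lambda>j. lpairing j v < 0) J"
      using root_cases[OF v(1) assms(7)] orthogonal_vec[OF v(3) assms(4)] root_length by blast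
    moreover have "E8.pairing j c < 0" if "j \<in> set J" "lpairing j v < 0" for j
      using that assms(3) v root_length[OF v(1)] by (subst v(2), subst pairing_vec) auto
    ultimately show "c \<in> fst ` ?T \<or> (\<exists>j\<in>set J. E8.pairing j c < 0)"
      by (force simp: list_ex_iff v(2))
  qed (use assms(2) in auto)
  then show ?thesis by (force simp: list_ex_iff)
qed

lemma splits_final_check:
  assumes "E8.splits x (vec ` set \<Theta>) r" "K \<in> lists E8_nodes"
    "list_all (\<lambda>t. length t = 8) \<Theta>"
    "list_all (\<lambda>v. list_all (\<lambda>t. lform v t = 0) \<Theta> \<longrightarrow> v \<in> set (map unit K)) roots"
  shows "\<exists>ws\<in>set (subseqs K). E8.conjugate x (ws @ r)"
proof (rule E8.splits_final[OF assms(1)])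
  show "set K \<subseteq> E8_nodes" using assms(2) by auto
  fix c assume "c \<in> vec ` root_set" "\<forall>t\<in>vec ` set \<Theta>. E8.form c t = 0"
  then obtain v where v: "v \<in> root_set" "c = vec v" "\<forall>t\<in>vec ` set \<Theta>. E8.form (vec v) t = 0"
    by blast
  then have "v \<in> set (map unit K)"
    using root_cases[OF v(1) assms(4)] orthogonal_vec[OF v(3) assms(3)] root_length by blast
  then obtain k where "k \<in> set K" "v = unit k" by auto
  then have "c = E8.alpha k"
    using assms(2) v(2) alpha_eq_vec[of k] by auto
  then show "c \<in> E8.alpha ` set K"
    using \<open>k \<in> set K\<close> by blast
qed

text \<open>The highest roots of \<open>E\<^sub>8\<close>, of the \<open>E\<^sub>7\<close> orthogonal to it, of the \<open>D\<^sub>6\<close> orthogonal to both, and of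
  the \<open>D\<^sub>4\<close> in the \<open>A\<^sub>1 + D\<^sub>4\<close> (nodes 7 and 2, 3, 4, 5) orthogonal to all three.  The words \<open>u8\<close>, \<open>u7\<close>,
  \<open>u6\<close>, \<open>u4\<close> carry a simple root to them.\<close>

definition "theta8 = [2,3,4,6,5,4,3,2 :: int]"
definition "theta7 = [2,2,3,4,3,2,1,0 :: int]"
definition "theta6 = [0,1,1,2,2,2,1,0 :: int]"
definition "theta4 = [0,1,1,2,1,0,0,0 :: int]"

definition "u8 = [8,7,6,5,4,2,3,1,4,3,5,4,2,6,5,4,3,1,7,6,5,4,2,3,4,5,6,7 :: nat]"
definition "u7 = [1,3,4,2,5,4,3,1,6,5,4,2,3,4,5,6 :: nat]"
definition "u6 = [6,5,4,2,3,4,5,6 :: nat]"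
definition "u4 = [4,2,3,4 :: nat]"

definition "r8 = u8 @ [8] @ rev u8"
definition "r7 = u7 @ [7] @ rev u7"
definition "r6 = u6 @ [7] @ rev u6"
definition "r4 = u4 @ [5] @ rev u4"

lemmas theta_defs = theta8_def theta7_def theta6_def theta4_def
lemmas word_defs = r8_def r7_def r6_def r4_def u8_def u7_def u6_def u4_def

lemma reflection_words:
  "E8.reflection_word r8 (vec theta8)" "E8.reflection_word r7 (vec theta7)"
  "E8.reflection_word r6 (vec theta6)" "E8.reflection_word r4 (vec theta4)"
  "E8.reflection_word [7] (vec (unit 7))"
proof -
  show "E8.reflection_word [7] (vec (unit 7))"
    using E8.reflection_word_simple[of 7] by (simp add: alpha_eq_vec)
qed (unfold r8_def r7_def r6_def r4_def; rule reflection_word_lact;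
    simp add: u8_def u7_def u6_def u4_def theta_defs lact_def unit_simps lrefl_simps)+

text \<open>The possible outcomes of the splitting. The first five words arise when nothing is left
  over before \<open>theta4\<close> is used. The two families correspond to splitting off
  \<open>theta4\<close> directly or only after \<open>alpha 7\<close>; they overlap in the group,
  since 7 commutes with the words in 2, 3, 4, 5.\<close>

definition orthogonal_words :: "nat list list" where
  "orthogonal_words =
    [[], r8, r7 @ r8, r6 @ r7 @ r8, [7] @ r6 @ r7 @ r8] @
    map (\<lambda>ws. ws @ r4 @ r6 @ r7 @ r8) (subseqs [7, 2, 3, 5]) @
    map (\<lambda>ws. ws @ r4 @ [7] @ r6 @ r7 @ r8) (subseqs [2, 3, 5])"

lemma involutive_conjugate_orthogonal_word:
  assumes "E8.involutive x"
  shows "\<exists>c\<in>set orthogonal_words. E8.conjugate x c"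
proof -
  note check = theta_defs roots_def lform_simps lpairing_simps lrefl_simps unit_simps
  have x: "x \<in> lists E8_nodes"
    using assms by (simp add: E8.involutive_def)
  have 0: "E8.splits x (vec ` set []) []"
    using E8.splits_empty[OF assms] by simp
  have 1: "E8.conjugate x [] \<or> E8.splits x (vec ` set [theta8]) r8"
    using splits_check[OF 0 x, of "[1,2,3,4,5,6,7,8]" "[(theta8, r8)]"]
    by (simp add: reflection_words) (simp add: check)
  have 2: "E8.conjugate x r8 \<or> E8.splits x (vec ` set [theta7, theta8]) (r7 @ r8)"
    if "E8.splits x (vec ` set [theta8]) r8"
    using splits_check[OF that x, of "[1,2,3,4,5,6,7]" "[(theta7, r7)]"]
    by (simp add: reflection_words) (simp add: check)
  have 3: "E8.conjugate x (r7 @ r8) \<or> E8.splits x (vec ` set [theta6, theta7, theta8]) (r6 @ r7 @ r8)"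
    if "E8.splits x (vec ` set [theta7, theta8]) (r7 @ r8)"
    using splits_check[OF that x, of "[2,3,4,5,6,7]" "[(theta6, r6)]"]
    by (simp add: reflection_words) (simp add: check)
  \<comment> \<open>A1 + D4 is reducible, so there are two dominant roots and the argument branches.
    The letter 7 would only change the sign of the A1 root, so \<open>J\<close> consists of the D4
    nodes.\<close>
  have 4: "E8.conjugate x (r6 @ r7 @ r8)
      \<or> E8.splits x (vec ` set [theta4, theta6, theta7, theta8]) (r4 @ r6 @ r7 @ r8)
      \<or> E8.splits x (vec ` set [unit 7, theta6, theta7, theta8]) ([7] @ r6 @ r7 @ r8)"
    if "E8.splits x (vec ` set [theta6, theta7, theta8]) (r6 @ r7 @ r8)"
    using splits_check[OF that x, of "[2,3,4,5]" "[(theta4, r4), (unit 7, [7])]"]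
    by (simp add: reflection_words) (simp add: check)
  have 5: "E8.conjugate x ([7] @ r6 @ r7 @ r8)
      \<or> E8.splits x (vec ` set [theta4, unit 7, theta6, theta7, theta8]) (r4 @ [7] @ r6 @ r7 @ r8)"
    if "E8.splits x (vec ` set [unit 7, theta6, theta7, theta8]) ([7] @ r6 @ r7 @ r8)"
    using splits_check[OF that x, of "[2,3,4,5]" "[(theta4, r4)]"]
    by (simp add: reflection_words) (simp add: check)
  \<comment> \<open>Orthogonal to \<open>theta4\<close> in D4 there remain only the pairwise
    orthogonal simple roots 2, 3, 5; with 7 they are few enough to list all subsets.\<close>
  have 6: "\<exists>ws\<in>set (subseqs [7,2,3,5]). E8.conjugate x (ws @ r4 @ r6 @ r7 @ r8)"
    if "E8.splits x (vec ` set [theta4, theta6, theta7, theta8]) (r4 @ r6 @ r7 @ r8)"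
    by (rule splits_final_check[OF that]) (simp_all add: check)
  have 7: "\<exists>ws\<in>set (subseqs [2,3,5]). E8.conjugate x (ws @ r4 @ [7] @ r6 @ r7 @ r8)"
    if "E8.splits x (vec ` set [theta4, unit 7, theta6, theta7, theta8]) (r4 @ [7] @ r6 @ r7 @ r8)"
    by (rule splits_final_check[OF that]) (simp_all add: check)
  show ?thesis
    using 1 2 3 4 5 6 7 unfolding orthogonal_words_def
    by (simp only: set_append set_map list.set Un_iff insert_iff bex_Un bex_simps) blast
qed

subsection \<open>Conjugating to longest elements\<close>

text \<open>In types \<open>E\<^sub>8\<close>, \<open>E\<^sub>7\<close>, \<open>D\<^sub>6\<close>, \<open>D\<^sub>4\<close>, with Coxeter numbers 30, 18, 10, 6, half the Coxeter
  number is the power of a Coxeter element that equals \<open>-1\<close>.\<close>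

definition "w8 = concat (replicate 15 [1,2,3,4,5,6,7,8 :: nat])"
definition "w7 = concat (replicate 9 [1,2,3,4,5,6,7 :: nat])"
definition "w6 = concat (replicate 5 [2,3,4,5,6,7 :: nat])"
definition "w4 = concat (replicate 3 [2,3,4,5 :: nat])"

lemma replicate_numeral: "replicate (numeral k) x = x # replicate (pred_numeral k) x"
  by (simp add: numeral_eq_Suc)

lemma replicate_one: "replicate 1 x = [x]"
  by (simp add: One_nat_def)

lemmas lact_simps = lact_def lrefl_simps units_simps unit_simps replicate_numeral replicate_one
  w8_def w7_def w6_def w4_def

lemma w8_in_lists: "w8 \<in> lists E8_nodes"
  by (simp add: w8_def replicate_numeral replicate_one)

lemma act_w8_alpha:
  assumes "s \<in> E8_nodes"
  shows "E8.act w8 (E8.alpha s) = (\<lambda>i. - E8.alpha s i)"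
proof -
  have "list_all (\<lambda>v. lact w8 v = map uminus v) units"
    by (simp add: lact_simps)
  then have "lact w8 (unit s) = map uminus (unit s)"
    using assms unfolding E8_nodes_eq units_def by auto
  then show ?thesis
    using assms w8_in_lists by (simp add: alpha_eq_vec act_vec length_unit vec_uminus)
qed

text \<open>Coordinates outside the nodes are never changed by \<open>act\<close>, so -1 can hold
  only for functions supported on the nodes.\<close>

lemma act_w8:
  assumes "\<And>i. i \<notin> E8_nodes \<Longrightarrow> v i = 0"
  shows "E8.act w8 v = (\<lambda>i. - v i)"
proof -
  have v: "v = (\<lambda>j. \<Sum>i\<in>E8_nodes. v i * E8.alpha i j)"
    using assms by (auto simp: E8.alpha_def if_distrib cong: if_cong)
  have "E8.act w8 v = (\<lambda>j. \<Sum>i\<in>E8_nodes. v i * E8.act w8 (E8.alpha i) j)"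
    by (subst v) (rule E8.act_sum, simp)
  also have "\<dots> = (\<lambda>j. - (\<Sum>i\<in>E8_nodes. v i * E8.alpha i j))"
    unfolding sum_negf[symmetric] by (intro ext sum.cong HOL.refl) (simp add: act_w8_alpha)
  finally show ?thesis using v by metis
qed

lemma act_w8_act_alpha:
  assumes "xs \<in> lists E8_nodes" "s \<in> E8_nodes"
  shows "E8.act w8 (E8.act xs (E8.alpha s)) = (\<lambda>i. - E8.act xs (E8.alpha s) i)"
proof (rule act_w8)
  fix i assume "i \<notin> E8_nodes"
  then show "E8.act xs (E8.alpha s) i = 0"
    using assms by (subst E8.act_outside[OF assms(1)]) (auto simp: E8.alpha_def)
qed

lemma cls_w8_commute:
  assumes "xs \<in> lists E8_nodes"
  shows "E8.cls (w8 @ xs) = E8.cls (xs @ w8)"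
  using assms w8_in_lists
  by (intro E8.faithful) (simp_all add: act_w8_act_alpha act_w8_alpha E8.act_minus)

lemma conjugate_check:
  assumes "g \<in> lists E8_nodes" "x \<in> lists E8_nodes" "y \<in> lists E8_nodes"
    "map (lact (g @ x)) units = map (lact (y @ g)) units"
  shows "E8.conjugate x y"
proof -
  have "E8.cls (g @ x) = E8.cls (y @ g)"
  proof (rule E8.faithful)
    fix s assume s: "s \<in> E8_nodes"
    then have "lact (g @ x) (unit s) = lact (y @ g) (unit s)"
      using assms(4) unfolding E8_nodes_eq units_def by auto
    moreover have "g @ x \<in> lists E8_nodes" "y @ g \<in> lists E8_nodes"
      using assms by auto
    ultimately show "E8.act (g @ x) (E8.alpha s) = E8.act (y @ g) (E8.alpha s)"
      using s by (simp only: alpha_eq_vec act_vec length_unit)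
  qed (use assms in auto)
  then have "E8.act (g @ x) = E8.act (y @ g)"
    using assms by (intro E8.act_cong) auto
  then show ?thesis
    using assms(1-3) by (intro E8.conjugateI[of g]) (simp_all flip: E8.act_append)
qed

text \<open>The central factor \<open>w8\<close> enters as a sign, which spares evaluating its 120
  letters.\<close>

lemma conjugate_w8_check:
  assumes "g \<in> lists E8_nodes" "x \<in> lists E8_nodes" "y \<in> lists E8_nodes"
    "map (lact (g @ x)) units = map (\<lambda>v. map uminus (lact (y @ g) v)) units"
  shows "E8.conjugate x (w8 @ y)"
proof -
  have "E8.cls (g @ x) = E8.cls (w8 @ y @ g)"
  proof (rule E8.faithful)
    fix s assume s: "s \<in> E8_nodes"
    then have "lact (g @ x) (unit s) = map uminus (lact (y @ g) (unit s))"
      using assms(4) unfolding E8_nodes_eq units_def by auto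
    moreover have gx: "g @ x \<in> lists E8_nodes" and yg: "y @ g \<in> lists E8_nodes"
      using assms by auto
    ultimately have "E8.act (g @ x) (E8.alpha s) = (\<lambda>i. - E8.act (y @ g) (E8.alpha s) i)"
      using s by (simp only: alpha_eq_vec act_vec length_unit vec_uminus length_lact)
    then show "E8.act (g @ x) (E8.alpha s) = E8.act (w8 @ y @ g) (E8.alpha s)"
      using act_w8_act_alpha[OF yg s] by (simp only: E8.act_append)
  qed (use assms w8_in_lists in auto)
  then have "E8.act (g @ x) = E8.act ((w8 @ y) @ g)"
    using assms w8_in_lists by (intro E8.act_cong) auto
  then show ?thesis
    using assms(1-3) w8_in_lists by (intro E8.conjugateI[of g]) (simp_all flip: E8.act_append)
qed

text \<open>For each word \<open>c\<close> of \<^const>\<open>orthogonal_words\<close>, in order: a word \<open>g\<close> and a small word \<open>y\<close> with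
  \<open>g c g\<^sup>-\<^sup>1 = \<plusminus> y\<close>, the sign being \<open>+\<close> for \<^const>\<open>True\<close>.\<close>

definition conjugators :: "(nat list \<times> bool \<times> nat list) list" where
  "conjugators = [
    ([], True, []),
    ([3, 4, 5, 6, 7, 8, 2, 4, 5, 6, 7, 3, 4, 5, 6, 2, 4, 5, 3, 4, 1, 3, 2, 4, 5, 6, 7, 8], True,
    [1]),
    ([3, 4, 5, 6, 7, 8, 2, 4, 5, 6, 7, 3, 4, 5, 6, 2, 4, 5, 3, 4, 1, 3, 2, 4, 5, 6, 7, 8, 7, 5,
    4, 3, 2, 4, 5, 6, 1, 3, 4, 5, 2, 4, 3, 1], True, [1, 4]),
    ([7, 8, 5, 4, 3, 2, 4, 5, 6, 7, 1, 3, 4, 5, 6, 2, 4, 5, 3, 4, 1, 3, 2, 4, 5, 6, 7, 8, 5, 3,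
    4, 1, 3, 2, 4, 5, 6, 7, 6, 5, 3, 4, 1, 3, 2, 4, 5, 6, 2, 4, 3, 1], True, [1, 4, 6]),
    ([], False, w4),
    ([], False, []),
    ([3, 4, 5, 1, 3, 4], False, [1]),
    ([3, 1], False, [1]),
    ([5, 4, 3, 1], False, [1, 4]),
    ([3, 4, 1, 3, 2, 4], False, [1]),
    ([5, 6, 4, 5, 3, 4, 1, 3, 2, 4, 5, 6], False, [1, 4]),
    ([2, 4, 3, 1], False, [1, 4]),
    ([2, 4, 5, 6, 3, 1], False, [1, 4, 6]),
    ([3, 4, 5, 6, 7, 1, 3, 4, 5, 6], False, [1]),
    ([5, 6, 7, 4, 5, 6, 3, 4, 5, 1, 3, 4], False, [1, 4]),
    ([5, 6, 7, 4, 5, 6, 3, 1], False, [1, 4]),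
    ([7, 6, 5, 4, 3, 1], False, [1, 4, 6]),
    ([5, 6, 7, 4, 5, 6, 3, 4, 1, 3, 2, 4], False, [1, 4]),
    ([7, 8, 6, 7, 5, 6, 4, 5, 3, 4, 1, 3, 2, 4, 5, 6, 7, 8], False, [1, 4, 6]),
    ([7, 6, 2, 4, 3, 1], False, [1, 4, 6]),
    ([2, 4, 5, 6, 7, 8, 3, 1], False, [1, 4, 6, 8]),
    ([], False, []),
    ([3, 4, 5, 1, 3, 4], False, [1]),
    ([3, 1], False, [1]),
    ([5, 4, 3, 1], False, [1, 4]),
    ([3, 4, 1, 3, 2, 4], False, [1]),
    ([5, 6, 4, 5, 3, 4, 1, 3, 2, 4, 5, 6], False, [1, 4]),
    ([2, 4, 3, 1], False, [1, 4]),
    ([2, 4, 5, 6, 3, 1], False, [1, 4, 6])]"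

text \<open>Up to sign at most four orthogonal roots occur. Four of them come in two types: simple
  roots as in \<open>[1,4,6,8]\<close>, or four spanning a D4, whose reflections multiply to a
  conjugate of \<open>w4\<close>.\<close>

definition small_words :: "nat list list" where
  "small_words = [[], [1], [1,4], [1,4,6], [1,4,6,8], w4]"

lemma conjugators_check:
  "list_all2 (\<lambda>c (g, b, y). map (lact (g @ c)) units =
      map (\<lambda>v. if b then lact (y @ g) v else map uminus (lact (y @ g) v)) units)
    orthogonal_words conjugators"
  by (simp add: orthogonal_words_def conjugators_def lact_simps word_defs)

lemma conjugators_in_lists:
  "list_all (\<lambda>(g, b, y). g \<in> lists E8_nodes \<and> y \<in> set small_words) conjugators"
  by (simp add: conjugators_def small_words_def)

lemma orthogonal_words_in_lists: "list_all (\<lambda>c. c \<in> lists E8_nodes) orthogonal_words"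
  by (simp add: orthogonal_words_def word_defs)

lemma small_words_in_lists: "y \<in> set small_words \<Longrightarrow> y \<in> lists E8_nodes"
  by (auto simp: small_words_def w4_def replicate_numeral replicate_one)

lemma list_all2_ex: "list_all2 Q xs ys \<Longrightarrow> x \<in> set xs \<Longrightarrow> \<exists>y\<in>set ys. Q x y"
  by (induction rule: list_all2_induct) auto

lemma involutive_conjugate_small_word:
  assumes "E8.involutive x"
  shows "\<exists>y\<in>set small_words. E8.conjugate x y \<or> E8.conjugate x (w8 @ y)"
proof -
  obtain c where c: "c \<in> set orthogonal_words" "E8.conjugate x c"
    using involutive_conjugate_orthogonal_word[OF assms] by blast
  obtain g b y where gby: "(g, b, y) \<in> set conjugators"
    and eq: "map (lact (g @ c)) units =
      map (\<lambda>v. if b then lact (y @ g) v else map uminus (lact (y @ g) v)) units"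
    using list_all2_ex[OF conjugators_check c(1)] by blast
  have "g \<in> lists E8_nodes \<and> y \<in> set small_words" "c \<in> lists E8_nodes"
    using gby c(1) conjugators_in_lists orthogonal_words_in_lists unfolding list_all_iff by blast+
  moreover have "x \<in> lists E8_nodes"
    using assms by (simp add: E8.involutive_def)
  ultimately have mem: "g \<in> lists E8_nodes" "y \<in> set small_words" "y \<in> lists E8_nodes"
      "c \<in> lists E8_nodes" "x \<in> lists E8_nodes"
    using small_words_in_lists by blast+
  have "E8.conjugate c (if b then y else w8 @ y)"
    using eq mem conjugate_check[of g c y] conjugate_w8_check[of g c y]
    by (cases b) (simp_all only: if_True if_False)
  then have "E8.conjugate x (if b then y else w8 @ y)"
    by (rule E8.conjugate_trans[OF c(2)]) (use mem w8_in_lists in simp_all)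
  then show ?thesis
    using mem(2) by (cases b) (simp_all only: if_True if_False, blast+)
qed

section \<open>Longest elements as words, and multiplication by the central element\<close>

lemma (in group) l_coset_conj_class:
  assumes "z \<in> carrier G" "x \<in> carrier G" "\<And>g. g \<in> carrier G \<Longrightarrow> z \<otimes> g = g \<otimes> z"
  shows "z <# conj_class G x = conj_class G (z \<otimes> x)"
proof -
  have "z \<otimes> (g \<otimes> x \<otimes> inv g) = g \<otimes> (z \<otimes> x) \<otimes> inv g" if "g \<in> carrier G" for g
    using assms(1,2) assms(3)[OF that] that by (simp flip: m_assoc)
  then show ?thesis
    unfolding l_coset_def conj_class_def by auto
qed

text \<open>Pairwise non-adjacent nodes give the product of their generators; an A1 component next
  to D4 contributes one commuting letter. The last five entries are the alternative
  representatives.\<close>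

definition longest_words :: "(nat list \<times> nat list) list" where
  "longest_words =
    [([], []), ([1,2,3,4,5,6,7,8], w8), ([1], [1]), ([1,2,3,4,5,6,7], w7),
     ([1,4], [1,4]), ([2,3,4,5,6,7], w6), ([1,4,6], [1,4,6]), ([2,3,4,5,7], w4 @ [7]),
     ([1,4,6,8], [1,4,6,8]), ([2,3,4,5], w4),
     ([3], [3]), ([1,5], [1,5]), ([1,2,8], [1,2,8]), ([2,3,4,5,8], w4 @ [8]),
     ([1,2,6,8], [1,2,6,8])]"

lemma longest_words_check:
  "list_all (\<lambda>(I, w). I \<in> lists E8_nodes \<and> w \<in> lists (set I) \<and>
     list_all (\<lambda>i. lact w (unit i) = map uminus (unit i)) I) longest_words"
  by (simp add: longest_words_def lact_simps)

lemma longest_word: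
  assumes "(I, w) \<in> set longest_words"
  shows "w_E8 (set I) = E8.cls w" "w \<in> lists E8_nodes" "E8.cls (w @ w) = E8.cls []"
proof -
  have I: "set I \<subseteq> E8_nodes" and w: "w \<in> lists (set I)"
    and act: "\<And>i. i \<in> set I \<Longrightarrow> lact w (unit i) = map uminus (unit i)"
    using assms longest_words_check by (auto simp: list_all_iff)
  show wS: "w \<in> lists E8_nodes" using I w by auto
  have "E8.act w (E8.alpha i) = (\<lambda>j. - E8.alpha i j)" if "i \<in> set I" for i
  proof -
    have "i \<in> E8_nodes" using that I by blast
    then show ?thesis
      by (simp add: alpha_eq_vec act_vec[OF wS length_unit] act[OF that] vec_uminus length_unit)
  qed
  note longest = E8.longest_element_eq[OF I w this]
  show "w_E8 (set I) = E8.cls w"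
    using longest(1) by (simp add: w_E8_def)
  show "E8.cls (w @ w) = E8.cls []"
    by (rule longest(3))
qed

definition word_class :: "nat list \<Rightarrow> nat list set set" where
  "word_class w = conj_class W_E8 (E8.cls w)"

lemma cl_E8_eq: "(I, w) \<in> set longest_words \<Longrightarrow> cl_E8 (set I) = word_class w"
  by (simp add: cl_E8_def word_class_def longest_word)

lemma word_class_eqI:
  "E8.conjugate x y \<Longrightarrow> x \<in> lists E8_nodes \<Longrightarrow> y \<in> lists E8_nodes \<Longrightarrow> word_class x = word_class y"
  by (simp only: word_class_def W_E8_def E8.conj_class_eq_iff)

lemma wo_E8_eq: "wo_E8 = E8.cls w8"
  using longest_word(1)[of "[1,2,3,4,5,6,7,8]" w8]
  by (simp add: wo_E8_def longest_words_def E8_nodes_eq)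

lemma w8_w8: "E8.cls (w8 @ w8) = E8.cls []"
  using longest_word(3)[of "[1,2,3,4,5,6,7,8]" w8] by (simp add: longest_words_def)

lemma wo_E8_central:
  assumes "x \<in> carrier W_E8"
  shows "wo_E8 \<otimes>\<^bsub>W_E8\<^esub> x = x \<otimes>\<^bsub>W_E8\<^esub> wo_E8"
proof -
  obtain xs where "xs \<in> lists E8_nodes" "x = E8.cls xs"
    using assms by (auto simp: W_E8_def E8.carrier_W)
  then show ?thesis
    using w8_in_lists cls_w8_commute by (simp add: wo_E8_eq W_E8_def E8.mult_W)
qed

lemma wo_E8_in_carrier: "wo_E8 \<in> carrier W_E8"
  using w8_in_lists by (auto simp: wo_E8_eq W_E8_def E8.carrier_W)

lemma wo_l_coset:
  assumes "x \<in> lists E8_nodes"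
  shows "wo_E8 <#\<^bsub>W_E8\<^esub> word_class x = word_class (w8 @ x)"
proof -
  have "E8.cls x \<in> carrier W_E8"
    using assms by (auto simp: W_E8_def E8.carrier_W)
  moreover have "wo_E8 \<otimes>\<^bsub>W_E8\<^esub> E8.cls x = E8.cls (w8 @ x)"
    using assms w8_in_lists by (simp add: wo_E8_eq W_E8_def E8.mult_W)
  ultimately show ?thesis
    using group.l_coset_conj_class[OF group_W_E8 wo_E8_in_carrier _ wo_E8_central]
    by (simp add: word_class_def)
qed

lemma wo_swaps:
  assumes "E8.conjugate y (w8 @ x)" "x \<in> lists E8_nodes" "y \<in> lists E8_nodes"
  shows "wo_E8 <#\<^bsub>W_E8\<^esub> word_class x = word_class y"
    and "wo_E8 <#\<^bsub>W_E8\<^esub> word_class y = word_class x"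
proof -
  have y: "word_class y = word_class (w8 @ x)"
    using assms w8_in_lists by (intro word_class_eqI) auto
  then show "wo_E8 <#\<^bsub>W_E8\<^esub> word_class x = word_class y"
    using wo_l_coset[OF assms(2)] by simp
  have "E8.cls ((w8 @ w8) @ x) = E8.cls ([] @ x)"
    using assms w8_in_lists by (intro E8.cls_append_cong w8_w8) auto
  then show "wo_E8 <#\<^bsub>W_E8\<^esub> word_class y = word_class x"
    unfolding y using assms w8_in_lists by (subst wo_l_coset) (simp_all add: word_class_def)
qed

text \<open>E7, D6 and A1 + D4 are the orthogonal complements of the first one, two and three chain
  roots, so \<open>w7\<close>, \<open>w6\<close> and \<open>w4 @ [7]\<close> are \<open>-r8\<close>,
  \<open>-(r7 @ r8)\<close> and \<open>-(r6 @ r7 @ r8)\<close>; their words \<open>g\<close> are the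
  ones that \<open>conjugators\<close> lists for these products. In the last two cases
  \<open>g\<close> interchanges the two four-dimensional eigenspaces.\<close>

lemma conjugate_w8:
  "E8.conjugate w7 (w8 @ [1])"
  "E8.conjugate w6 (w8 @ [1,4])"
  "E8.conjugate (w4 @ [7]) (w8 @ [1,4,6])"
  "E8.conjugate [1,4,6,8] (w8 @ [1,4,6,8])"
  "E8.conjugate w4 (w8 @ w4)"
proof -
  show "E8.conjugate w7 (w8 @ [1])"
    by (rule conjugate_w8_check[where g = "[3,4,5,6,7,8,2,4,5,6,7,3,4,5,6,2,4,5,3,4,1,3,2,4,5,6,7,8]"]) (simp_all add: lact_simps)
  show "E8.conjugate w6 (w8 @ [1,4])"
    by (rule conjugate_w8_check[where g = "[3,4,5,6,7,8,2,4,5,6,7,3,4,5,6,2,4,5,3,4,1,3,2,4,5,6,7,8,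
        7,5,4,3,2,4,5,6,1,3,4,5,2,4,3,1]"])
      (simp_all add: lact_simps)
  show "E8.conjugate (w4 @ [7]) (w8 @ [1,4,6])"
    by (rule conjugate_w8_check[where g = "[7,8,5,4,3,2,4,5,6,7,1,3,4,5,6,2,4,5,3,4,1,3,2,4,5,6,7,8,
        5,3,4,1,3,2,4,5,6,7,6,5,3,4,1,3,2,4,5,6,2,4,3,1]"])
      (simp_all add: lact_simps)
  show "E8.conjugate [1,4,6,8] (w8 @ [1,4,6,8])"
    by (rule conjugate_w8_check[where g = "[7,5,6,2,4,5,3,4,1,3,2,4,5,6,7,8,4,3,2,4,5,6,7,1,3,4,5,6,
        2,4,5,3,4,1,3,2,4,5,6,7,4,5,6,4,5,3,4,1,3,2,4,5,4,1,3,2]"])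
      (simp_all add: lact_simps)
  show "E8.conjugate w4 (w8 @ w4)"
    by (rule conjugate_w8_check[where g = "[6,7,8,5,6,7,1,3,4,5,6,2,4,5,3,4,1,3,2,4,5,6,7,8,6,4,5,3,
        4,1,3,2,4,5,6,7,3,4,1,3,2,4,5,6,2,4,3,1]"])
      (simp_all add: lact_simps)
qed

text \<open>The last item links \<open>w4 @ [8]\<close> to \<open>w4 @ [7]\<close>, since both are
  conjugate to \<open>w8 @ [1,4,6]\<close>.\<close>

lemma conjugate_alternatives:
  "E8.conjugate [3] [1]" "E8.conjugate [1,5] [1,4]" "E8.conjugate [1,2,8] [1,4,6]"
  "E8.conjugate [1,2,6,8] [1,4,6,8]" "E8.conjugate (w4 @ [8]) (w8 @ [1,4,6])"
proof -
  show "E8.conjugate [3] [1]"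
    by (rule conjugate_check[where g = "[3,1]"]) (simp_all add: lact_simps)
  show "E8.conjugate [1,5] [1,4]"
    by (rule conjugate_check[where g = "[5,4]"]) (simp_all add: lact_simps)
  show "E8.conjugate [1,2,8] [1,4,6]"
    by (rule conjugate_check[where g = "[7,8,6,7,2,4]"]) (simp_all add: lact_simps)
  show "E8.conjugate [1,2,6,8] [1,4,6,8]"
    by (rule conjugate_check[where g = "[2,4]"]) (simp_all add: lact_simps)
  show "E8.conjugate (w4 @ [8]) (w8 @ [1,4,6])"
    by (rule conjugate_w8_check[where g = "[7,8,5,6,7,3,4,5,6,2,4,5,3,4,1,3,2,4,5,6,7,8,5,6,7,4,5,6,
        2,4,5,3,4,1,3,2,4,5,6,7,3,4,1,3,2,4,5,6,2,4,3,1]"])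
      (simp_all add: lact_simps)
qed

section \<open>Counting negated roots\<close>

lemma card_negated_eq:
  assumes "x \<in> lists E8_nodes"
  shows "card (E8.negated x) = length (filter (\<lambda>v. lact x v = map uminus v) roots)"
    and "card (E8.negated (w8 @ x)) = length (filter (\<lambda>v. lact x v = v) roots)"
proof -
  have "inj_on vec {v \<in> root_set. Q v}" for Q
    using root_length vec_inject by (intro inj_onI) blast
  then have card: "card (vec ` {v \<in> root_set. Q v}) = length (filter Q roots)" for Q
    using distinct_card[OF distinct_filter[OF distinct_roots], of Q]
    by (simp add: card_image root_set_def)
  have act: "E8.act x (vec v) = (\<lambda>i. - vec v i) \<longleftrightarrow> lact x v = map uminus v" if "v \<in> root_set" for v
    using root_length[OF that] assms
    by (simp add: act_vec length_lact vec_inject flip: vec_uminus)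
  have "E8.negated x = vec ` {v \<in> root_set. lact x v = map uminus v}"
    using act by (auto simp: E8.negated_def)
  then show "card (E8.negated x) = length (filter (\<lambda>v. lact x v = map uminus v) roots)"
    by (simp add: card)
  have "E8.act (w8 @ x) (vec v) = (\<lambda>i. - vec v i) \<longleftrightarrow> lact x v = v" if "v \<in> root_set" for v
  proof -
    have len: "length v = 8" by (rule root_length[OF that])
    have "E8.act (w8 @ x) (vec v) = (\<lambda>i. - vec (lact x v) i)"
      unfolding E8.act_append act_vec[OF assms len]
    proof (rule act_w8)
      show "vec (lact x v) i = 0" if "i \<notin> E8_nodes" for i
        using that unfolding vec_def by (rule if_not_P)
    qed
    then have "E8.act (w8 @ x) (vec v) = (\<lambda>i. - vec v i) \<longleftrightarrow> vec (lact x v) = vec v"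
      by (auto simp: fun_eq_iff)
    then show ?thesis using len by (simp add: vec_inject length_lact)
  qed
  then have "E8.negated (w8 @ x) = vec ` {v \<in> root_set. lact x v = v}"
    by (auto simp: E8.negated_def)
  then show "card (E8.negated (w8 @ x)) = length (filter (\<lambda>v. lact x v = v) roots)"
    by (simp add: card)
qed

text \<open>A root is negated by \<open>w8 @ y\<close> exactly when \<open>y\<close> fixes it, so
  the long words are counted through their conjugates \<open>w8 @ y\<close> with \<open>y\<close> of
  at most three letters.\<close>

lemma card_negated:
  "card (E8.negated []) = 0" "card (E8.negated w8) = 120"
  "card (E8.negated [1]) = 1" "card (E8.negated w7) = 63"
  "card (E8.negated [1,4]) = 2" "card (E8.negated w6) = 30"
  "card (E8.negated [1,4,6]) = 3" "card (E8.negated (w4 @ [7])) = 13"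
  "card (E8.negated [1,4,6,8]) = 4" "card (E8.negated w4) = 12"
proof -
  have lists: "w7 \<in> lists E8_nodes" "w6 \<in> lists E8_nodes" "w4 \<in> lists E8_nodes"
    by (simp_all add: lact_simps)
  note count = lact_simps roots_def
  show "card (E8.negated []) = 0"
    by (subst card_negated_eq) (simp_all add: count)
  show "card (E8.negated w8) = 120"
    using card_negated_eq(2)[of "[]"] by (simp add: lact_def) (simp add: roots_def)
  show "card (E8.negated [1]) = 1"
    by (subst card_negated_eq) (simp_all add: count)
  show "card (E8.negated [1,4]) = 2"
    by (subst card_negated_eq) (simp_all add: count)
  show "card (E8.negated [1,4,6]) = 3"
    by (subst card_negated_eq) (simp_all add: count)
  show "card (E8.negated [1,4,6,8]) = 4"
    by (subst card_negated_eq) (simp_all add: count)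
  show "card (E8.negated w4) = 12"
    using lists by (subst card_negated_eq) (simp_all add: count)
  show "card (E8.negated w7) = 63"
  proof -
    have "card (E8.negated w7) = card (E8.negated (w8 @ [1]))"
      using lists w8_in_lists by (intro E8.card_negated_cong conjugate_w8) auto
    also have "\<dots> = 63"
      by (subst card_negated_eq) (simp_all add: count)
    finally show ?thesis .
  qed
  show "card (E8.negated w6) = 30"
  proof -
    have "card (E8.negated w6) = card (E8.negated (w8 @ [1,4]))"
      using lists w8_in_lists by (intro E8.card_negated_cong conjugate_w8) auto
    also have "\<dots> = 30"
      by (subst card_negated_eq) (simp_all add: count)
    finally show ?thesis .
  qed
  show "card (E8.negated (w4 @ [7])) = 13"
  proof -
    have "card (E8.negated (w4 @ [7])) = card (E8.negated (w8 @ [1,4,6]))"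
      using lists w8_in_lists by (intro E8.card_negated_cong conjugate_w8) auto
    also have "\<dots> = 13"
      by (subst card_negated_eq) (simp_all add: count)
    finally show ?thesis .
  qed
qed

section \<open>The ten classes\<close>

definition class_words :: "nat list list" where
  "class_words = [[], w8, [1], w7, [1,4], w6, [1,4,6], w4 @ [7], [1,4,6,8], w4]"

lemma class_words_longest: "w \<in> set class_words \<Longrightarrow> \<exists>I. (I, w) \<in> set longest_words"
proof -
  have "set class_words \<subseteq> snd ` set longest_words"
    by (simp add: class_words_def longest_words_def)
  then show "w \<in> set class_words \<Longrightarrow> \<exists>I. (I, w) \<in> set longest_words"
    by force
qed

lemma distinct_word_classes: "distinct (map word_class class_words)"
proof -
  have "distinct (map (\<lambda>w. card (E8.negated w)) class_words)"
    by (simp add: class_words_def card_negated)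
  moreover have "card (E8.negated v) = card (E8.negated w)"
    if "v \<in> set class_words" "w \<in> set class_words" "word_class v = word_class w" for v w
  proof -
    have "v \<in> lists E8_nodes" "w \<in> lists E8_nodes"
      using that(1,2) class_words_longest longest_word(2) by blast+
    moreover from this have "E8.conjugate v w"
      using that(3) by (simp only: word_class_def W_E8_def E8.conj_class_eq_iff)
    ultimately show ?thesis by (intro E8.card_negated_cong)
  qed
  ultimately show ?thesis
    unfolding distinct_map inj_on_def by blast
qed

lemma involution_classes: "conj_class W_E8 ` involutions W_E8 = word_class ` set class_words"
proof (intro equalityI subsetI)
  fix c assume "c \<in> conj_class W_E8 ` involutions W_E8"
  then obtain xs where xs: "xs \<in> lists E8_nodes" "c = word_class xs"
      "E8.cls xs \<otimes>\<^bsub>W_E8\<^esub> E8.cls xs = \<one>\<^bsub>W_E8\<^esub>"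
    by (auto simp: involutions_def W_E8_def E8.carrier_W word_class_def)
  then have "E8.cls (xs @ xs) = E8.cls []"
    by (simp add: W_E8_def E8.mult_W E8.one_W)
  then have "E8.involutive xs"
    using xs(1) E8.cls_eq_iff_act[of "xs @ xs" "[]"] by (simp add: E8.involutive_def)
  then obtain y where y: "y \<in> set small_words" "E8.conjugate xs y \<or> E8.conjugate xs (w8 @ y)"
    using involutive_conjugate_small_word by blast
  then have "c = word_class y \<or> c = word_class (w8 @ y)"
    using xs small_words_in_lists[OF y(1)] w8_in_lists word_class_eqI[of xs y]
      word_class_eqI[of xs "w8 @ y"] by auto
  moreover have lists: "w7 \<in> lists E8_nodes" "w6 \<in> lists E8_nodes" "w4 \<in> lists E8_nodes"
    by (simp_all add: lact_simps)
  have "word_class (w8 @ [1]) = word_class w7" "word_class (w8 @ [1,4]) = word_class w6"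
    "word_class (w8 @ [1,4,6]) = word_class (w4 @ [7])"
    "word_class (w8 @ [1,4,6,8]) = word_class [1,4,6,8]" "word_class (w8 @ w4) = word_class w4"
    using lists w8_in_lists by (intro word_class_eqI[symmetric] conjugate_w8; simp)+
  then have "list_all (\<lambda>y. word_class y \<in> word_class ` set class_words \<and>
      word_class (w8 @ y) \<in> word_class ` set class_words) small_words"
    by (simp add: small_words_def class_words_def)
  ultimately show "c \<in> word_class ` set class_words"
    using y(1) by (auto simp: list_all_iff)
next
  fix c assume "c \<in> word_class ` set class_words"
  then obtain w where w: "w \<in> set class_words" "c = word_class w" by blast
  then have "w \<in> lists E8_nodes" "E8.cls (w @ w) = E8.cls []"
    using class_words_longest longest_word(2,3) by blast+
  then have "E8.cls w \<in> involutions W_E8"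
    by (auto simp: involutions_def W_E8_def E8.carrier_W E8.mult_W E8.one_W)
  then show "c \<in> conj_class W_E8 ` involutions W_E8"
    using w(2) by (auto simp: word_class_def)
qed

section \<open>Maximal length of the longest element and its action as -1\<close>

lemma wo_E8_longest:
  assumes "x \<in> carrier W_E8"
  shows "coxeter_length x \<le> coxeter_length wo_E8"
proof -
  have "x \<in> parabolic E8_nodes E8_matrix E8_nodes"
    using assms by (simp add: E8.parabolic_eq W_E8_def E8.carrier_W)
  then show ?thesis
    unfolding wo_E8_eq using E8.longest_element_eq(2)[OF _ w8_in_lists act_w8_alpha] by blast
qed

lemma wo_E8_acts_as_minus_one:
  "\<exists>\<rho>. is_reflection_rep E8_nodes E8_matrix \<rho> \<and>
    (\<forall>v\<in>refl_space E8_nodes. \<rho> wo_E8 v = (\<lambda>i. - v i))"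
proof -
  obtain \<rho> where \<rho>: "is_reflection_rep E8_nodes E8_matrix \<rho>"
    "\<forall>xs\<in>lists E8_nodes. \<forall>v\<in>refl_space E8_nodes. \<rho> (E8.cls xs) v = E8.act xs v"
    using E8.ex_reflection_rep by blast
  moreover have "\<rho> wo_E8 v = (\<lambda>i. - v i)" if "v \<in> refl_space E8_nodes" for v
  proof -
    have "v i = 0" if "i \<notin> E8_nodes" for i
      using \<open>v \<in> refl_space E8_nodes\<close> that unfolding refl_space_def by blast
    then show ?thesis
      using \<rho>(2) w8_in_lists that act_w8[of v] unfolding wo_E8_eq by simp
  qed
  ultimately show ?thesis by blast
qed

lemma cl_E8_word_class:
  "cl_E8 {} = word_class []" "cl_E8 {1,2,3,4,5,6,7,8} = word_class w8"
  "cl_E8 {1} = word_class [1]" "cl_E8 {1,2,3,4,5,6,7} = word_class w7"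
  "cl_E8 {1,4} = word_class [1,4]" "cl_E8 {2,3,4,5,6,7} = word_class w6"
  "cl_E8 {1,4,6} = word_class [1,4,6]" "cl_E8 {2,3,4,5,7} = word_class (w4 @ [7])"
  "cl_E8 {1,4,6,8} = word_class [1,4,6,8]" "cl_E8 {2,3,4,5} = word_class w4"
  "cl_E8 {3} = word_class [3]" "cl_E8 {1,5} = word_class [1,5]"
  "cl_E8 {1,2,8} = word_class [1,2,8]" "cl_E8 {2,3,4,5,8} = word_class (w4 @ [8])"
  "cl_E8 {1,2,6,8} = word_class [1,2,6,8]"
proof -
  have "list_all (\<lambda>(I, w). cl_E8 (set I) = word_class w) longest_words"
    using cl_E8_eq by (auto simp: list_all_iff)
  note all = this[unfolded longest_words_def list.pred_inject prod.case list.set simp_thms]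
  show "cl_E8 {} = word_class []" "cl_E8 {1,2,3,4,5,6,7,8} = word_class w8"
    "cl_E8 {1} = word_class [1]" "cl_E8 {1,2,3,4,5,6,7} = word_class w7"
    "cl_E8 {1,4} = word_class [1,4]" "cl_E8 {2,3,4,5,6,7} = word_class w6"
    "cl_E8 {1,4,6} = word_class [1,4,6]" "cl_E8 {2,3,4,5,7} = word_class (w4 @ [7])"
    "cl_E8 {1,4,6,8} = word_class [1,4,6,8]" "cl_E8 {2,3,4,5} = word_class w4"
    "cl_E8 {3} = word_class [3]" "cl_E8 {1,5} = word_class [1,5]"
    "cl_E8 {1,2,8} = word_class [1,2,8]" "cl_E8 {2,3,4,5,8} = word_class (w4 @ [8])"
    "cl_E8 {1,2,6,8} = word_class [1,2,6,8]"
    using all by simp_all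
qed

theorem mainTheorem8:
  shows
    \<comment> \<open>the longest element is central and acts as -1\<close>
    "(wo_E8 \<in> carrier W_E8 \<and>
      (\<forall>x\<in>carrier W_E8. coxeter_length x \<le> coxeter_length wo_E8) \<and>
      (\<forall>x\<in>carrier W_E8. wo_E8 \<otimes>\<^bsub>W_E8\<^esub> x = x \<otimes>\<^bsub>W_E8\<^esub> wo_E8) \<and>
      (\<exists>\<rho>. is_reflection_rep E8_nodes E8_matrix \<rho> \<and>
        (\<forall>v\<in>refl_space E8_nodes. \<rho> wo_E8 v = (\<lambda>i. - v i)))) \<and>
    \<comment> \<open>the classes of involutions\<close>
     (let cs =
        [cl_E8 {}, cl_E8 {1,2,3,4,5,6,7,8},
         cl_E8 {1}, cl_E8 {1,2,3,4,5,6,7},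
         cl_E8 {1,4}, cl_E8 {2,3,4,5,6,7},
         cl_E8 {1,4,6}, cl_E8 {2,3,4,5,7},
         cl_E8 {1,4,6,8}, cl_E8 {2,3,4,5}]
      in length cs = 10 \<and> distinct cs \<and>
         conj_class W_E8 ` involutions W_E8 = set cs) \<and>
     cl_E8 {1} = cl_E8 {3} \<and>
     cl_E8 {1,4} = cl_E8 {1,5} \<and>
     cl_E8 {1,4,6} = cl_E8 {1,2,8} \<and>
     cl_E8 {2,3,4,5,7} = cl_E8 {2,3,4,5,8} \<and>
     cl_E8 {1,4,6,8} = cl_E8 {1,2,6,8} \<and>
    \<comment> \<open>the action of multiplication by the longest element\<close>
     (wo_E8 <#\<^bsub>W_E8\<^esub> cl_E8 {} = cl_E8 {1,2,3,4,5,6,7,8} \<and>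
      wo_E8 <#\<^bsub>W_E8\<^esub> cl_E8 {1,2,3,4,5,6,7,8} = cl_E8 {}) \<and>
     (wo_E8 <#\<^bsub>W_E8\<^esub> cl_E8 {1} = cl_E8 {1,2,3,4,5,6,7} \<and>
      wo_E8 <#\<^bsub>W_E8\<^esub> cl_E8 {1,2,3,4,5,6,7} = cl_E8 {1}) \<and>
     (wo_E8 <#\<^bsub>W_E8\<^esub> cl_E8 {1,4} = cl_E8 {2,3,4,5,6,7} \<and>
      wo_E8 <#\<^bsub>W_E8\<^esub> cl_E8 {2,3,4,5,6,7} = cl_E8 {1,4}) \<and>
     (wo_E8 <#\<^bsub>W_E8\<^esub> cl_E8 {1,4,6} = cl_E8 {2,3,4,5,7} \<and>
      wo_E8 <#\<^bsub>W_E8\<^esub> cl_E8 {2,3,4,5,7} = cl_E8 {1,4,6}) \<and>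
     wo_E8 <#\<^bsub>W_E8\<^esub> cl_E8 {1,4,6,8} = cl_E8 {1,4,6,8} \<and>
     wo_E8 <#\<^bsub>W_E8\<^esub> cl_E8 {2,3,4,5} = cl_E8 {2,3,4,5}"
proof -
  note cl = cl_E8_word_class
  have lists: "w7 \<in> lists E8_nodes" "w6 \<in> lists E8_nodes" "w4 \<in> lists E8_nodes"
    by (simp_all add: lact_simps)
  have alternatives: "word_class [1] = word_class [3]" "word_class [1,4] = word_class [1,5]"
    "word_class [1,4,6] = word_class [1,2,8]" "word_class [1,4,6,8] = word_class [1,2,6,8]"
    by (intro word_class_eqI[symmetric] conjugate_alternatives; simp)+
  have "word_class (w4 @ [8]) = word_class (w8 @ [1,4,6])"
    "word_class (w4 @ [7]) = word_class (w8 @ [1,4,6])"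
    using lists w8_in_lists by (intro word_class_eqI conjugate_alternatives conjugate_w8; simp)+
  then have D4A1: "word_class (w4 @ [7]) = word_class (w4 @ [8])" by simp
  have swap0: "wo_E8 <#\<^bsub>W_E8\<^esub> word_class [] = word_class w8"
      "wo_E8 <#\<^bsub>W_E8\<^esub> word_class w8 = word_class []"
    using wo_swaps[of w8 "[]"] E8.conjugate_refl w8_in_lists by simp_all
  have swap: "wo_E8 <#\<^bsub>W_E8\<^esub> word_class [1] = word_class w7"
      "wo_E8 <#\<^bsub>W_E8\<^esub> word_class w7 = word_class [1]"
      "wo_E8 <#\<^bsub>W_E8\<^esub> word_class [1,4] = word_class w6"
      "wo_E8 <#\<^bsub>W_E8\<^esub> word_class w6 = word_class [1,4]"
      "wo_E8 <#\<^bsub>W_E8\<^esub> word_class [1,4,6] = word_class (w4 @ [7])"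
      "wo_E8 <#\<^bsub>W_E8\<^esub> word_class (w4 @ [7]) = word_class [1,4,6]"
      "wo_E8 <#\<^bsub>W_E8\<^esub> word_class [1,4,6,8] = word_class [1,4,6,8]"
      "wo_E8 <#\<^bsub>W_E8\<^esub> word_class w4 = word_class w4"
    using lists by (intro wo_swaps conjugate_w8; simp)+
  have classes: "conj_class W_E8 ` involutions W_E8 = set (map word_class class_words)"
    "length (map word_class class_words) = 10"
    using involution_classes by (simp_all add: class_words_def)
  have list: "[cl_E8 {}, cl_E8 {1,2,3,4,5,6,7,8}, cl_E8 {1}, cl_E8 {1,2,3,4,5,6,7},
      cl_E8 {1,4}, cl_E8 {2,3,4,5,6,7}, cl_E8 {1,4,6}, cl_E8 {2,3,4,5,7},
      cl_E8 {1,4,6,8}, cl_E8 {2,3,4,5}] = map word_class class_words"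
    by (simp add: cl class_words_def)
  show ?thesis
    unfolding Let_def list unfolding cl
    by (intro conjI ballI;
        (rule wo_E8_in_carrier wo_E8_longest wo_E8_central wo_E8_acts_as_minus_one
          distinct_word_classes classes alternatives D4A1 swap0 swap; assumption))
qed

end
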